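(* Let $V=\mathscr{W}_L(\Gamma)\otimes\mathscr{W}_L(\Gamma)$, regarded as a $\mathscr{W}_L(\Gamma)$-module under the adjoint diagonal action. Every derivation from $\mathscr{W}_L(\Gamma)$ to $V$ is inner, i.e., $H^1(\mathscr{W}_L(\Gamma),V)=0$.
   Context: $\mathbb{F}$ is a field of characteristic zero; all tensor products are over $\mathbb{F}$. $\Gamma$ is an additive subgroup of $\mathbb{F}$ with $1\in\Gamma$. The group algebra $\mathbb{F}[\Gamma]$ has basis $\{e^\alpha\mid\alpha\in\Gamma\}$, and $\partial$ is the operator $\partial(e^\alpha)=\alpha e^\alpha$; $\mathscr{W}(\Gamma)=\mathbb{F}[\Gamma]\partial$. The generalized loop Virasoro algebra is $\mathscr{W}_L(\Gamma)=\mathscr{W}(\Gamma)\otimes\mathbb{F}[t^{\pm1}]$; it has basis $L_{\alpha,i}=e^\alpha\partial\otimes t^i$ ($\alpha\in\Gamma$, $i\in\mathbb{Z}$) and bracket $[L_{\alpha,i},L_{\beta,j}]=(\beta-\alpha)L_{\alpha+\beta,i+j}$. The adjoint diagonal action is $x\cdot(a\otimes b)=[x,a]\otimes b+a\otimes[x,b]$. A derivation from a Lie algebra $L$ to an $L$-module $V$ is a linear map $D:L\to V$ with $D([x,y])=x\cdot D(y)-y\cdot D(x)$; it is inner if there is $v\in V$ with $D(x)=x\cdot v$ for all $x\in L$. $H^1(L,V)\cong\mathrm{Der}(L,V)/\mathrm{Inn}(L,V)$, the quotient of the space of derivations by the space of inner derivations. *)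

theory Defs
  imports Complex_Main "HOL-Library.Poly_Mapping"
begin

section \<open>Vector spaces with a fixed basis\<close>

text \<open>
  The type \<open>'b \<Rightarrow>\<^sub>0 'f\<close> of finitely supported functions is the vector space over \<open>'f\<close> with
  basis \<open>single b 1\<close> for \<open>b :: 'b\<close>. When \<open>'b\<close> is a monoid, its library multiplication
  (convolution) makes it the monoid algebra.
\<close>

abbreviation "single \<equiv> Poly_Mapping.single"
abbreviation "lookup \<equiv> Poly_Mapping.lookup"
abbreviation "keys \<equiv> Poly_Mapping.keys"

definition scale :: "'f::field \<Rightarrow> ('b \<Rightarrow>\<^sub>0 'f) \<Rightarrow> ('b \<Rightarrow>\<^sub>0 'f)" where
  "scale c p = Poly_Mapping.map ((*) c) p"

lemma lookup_scale [simp]: "lookup (scale c p) k = c * lookup p k"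
  unfolding scale_def by transfer (simp add: when_def)

global_interpretation pm: vector_space scale
  by unfold_locales (auto intro!: poly_mapping_eqI simp: lookup_add algebra_simps)

lemma scale_single [simp]: "scale c (single k d) = single k (c * d)"
  by (rule poly_mapping_eqI) (simp add: lookup_single when_def)

definition lin_ext :: "('a \<Rightarrow> 'b \<Rightarrow>\<^sub>0 'f) \<Rightarrow> ('a \<Rightarrow>\<^sub>0 'f) \<Rightarrow> ('b \<Rightarrow>\<^sub>0 'f::field)" where
  "lin_ext f v = (\<Sum>k\<in>keys v. scale (lookup v k) (f k))"

definition bilin_ext ::
    "('a \<Rightarrow> 'b \<Rightarrow> 'c \<Rightarrow>\<^sub>0 'f) \<Rightarrow> ('a \<Rightarrow>\<^sub>0 'f) \<Rightarrow> ('b \<Rightarrow>\<^sub>0 'f) \<Rightarrow> ('c \<Rightarrow>\<^sub>0 'f::field)" where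
  "bilin_ext f u v = lin_ext (\<lambda>a. lin_ext (f a) v) u"

lemma lin_ext_superset:
  assumes "finite S" "keys v \<subseteq> S"
  shows "lin_ext f v = (\<Sum>k\<in>S. scale (lookup v k) (f k))"
  unfolding lin_ext_def using assms
  by (intro sum.mono_neutral_left) (auto simp: in_keys_iff)

lemma lin_ext_single [simp]: "lin_ext f (single k c) = scale c (f k)"
  by (subst lin_ext_superset[of "{k}"]) auto

lemma lin_ext_add: "lin_ext f (u + v) = lin_ext f u + lin_ext f v"
proof -
  let ?S = "keys u \<union> keys v"
  have "keys (u + v) \<subseteq> ?S" by (rule keys_add)
  then show ?thesis
    by (simp add: lin_ext_superset[of ?S] lookup_add pm.scale_left_distrib sum.distrib)
qed

lemma lin_ext_scale: "lin_ext f (scale c v) = scale c (lin_ext f v)"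
proof -
  have "keys (scale c v) \<subseteq> keys v" by (auto simp: in_keys_iff)
  then show ?thesis
    by (simp add: lin_ext_superset[of "keys v"] pm.scale_sum_right)
qed

lemma lin_ext_fun_add: "lin_ext (\<lambda>k. f k + g k) v = lin_ext f v + lin_ext g v"
  by (simp add: lin_ext_def pm.scale_right_distrib sum.distrib)

lemma lin_ext_fun_scale: "lin_ext (\<lambda>k. scale c (f k)) v = scale c (lin_ext f v)"
  by (simp add: lin_ext_def pm.scale_sum_right mult.commute)

lemma bilin_ext_add_left: "bilin_ext f (u + u') v = bilin_ext f u v + bilin_ext f u' v"
  by (simp add: bilin_ext_def lin_ext_add)

lemma bilin_ext_add_right: "bilin_ext f u (v + v') = bilin_ext f u v + bilin_ext f u v'"
  by (simp add: bilin_ext_def lin_ext_add lin_ext_fun_add)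

lemma bilin_ext_scale_left: "bilin_ext f (scale c u) v = scale c (bilin_ext f u v)"
  by (simp add: bilin_ext_def lin_ext_scale)

lemma bilin_ext_scale_right: "bilin_ext f u (scale c v) = scale c (bilin_ext f u v)"
  by (simp add: bilin_ext_def lin_ext_scale lin_ext_fun_scale)

lemma bilin_ext_single [simp]:
  "bilin_ext f (single a c) (single b d) = scale (c * d) (f a b)"
  by (simp add: bilin_ext_def)

lemma pm_induct [case_names single add]:
  assumes single: "\<And>k c. P (single k c)" and add: "\<And>u v. P u \<Longrightarrow> P v \<Longrightarrow> P (u + v)"
  shows "P (v :: 'b \<Rightarrow>\<^sub>0 'f::field)"
proof -
  have "P (\<Sum>k\<in>S. single k (lookup v k))" if "finite S" for S
    using that
  proof (induction S)
    case empty
    show ?case using single[of undefined 0] by simp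
  qed (simp add: single add)
  moreover have "v = (\<Sum>k\<in>keys v. single k (lookup v k))"
    by (rule poly_mapping_eqI)
       (simp add: lookup_sum lookup_single when_def in_keys_iff)
  ultimately show ?thesis by (metis finite_keys)
qed

subsection \<open>Tensor products\<close>

text \<open>
  \<open>('a \<Rightarrow>\<^sub>0 'f) \<otimes> ('b \<Rightarrow>\<^sub>0 'f)\<close> is realised on the product basis. As \<open>'f\<close> is a field, the
  tensor product of two subspaces is the span of the pure tensors inside it.
\<close>

definition tensor :: "('a \<Rightarrow>\<^sub>0 'f) \<Rightarrow> ('b \<Rightarrow>\<^sub>0 'f) \<Rightarrow> ('a \<times> 'b \<Rightarrow>\<^sub>0 'f::field)" where
  "tensor = bilin_ext (\<lambda>a b. single (a, b) 1)"

definition tensor_space ::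
    "('a \<Rightarrow>\<^sub>0 'f) set \<Rightarrow> ('b \<Rightarrow>\<^sub>0 'f) set \<Rightarrow> ('a \<times> 'b \<Rightarrow>\<^sub>0 'f::field) set" where
  "tensor_space A B = pm.span {tensor a b | a b. a \<in> A \<and> b \<in> B}"

lemma tensor_single [simp]: "tensor (single a c) (single b d) = single (a, b) (c * d)"
  by (simp add: tensor_def)

lemma tensor_add_left: "tensor (u + u') v = tensor u v + tensor u' v"
  and tensor_add_right: "tensor u (v + v') = tensor u v + tensor u v'"
  and tensor_scale_left: "tensor (scale c u) v = scale c (tensor u v)"
  and tensor_scale_right: "tensor u (scale c v) = scale c (tensor u v)"
  by (simp_all add: tensor_def bilin_ext_add_left bilin_ext_add_right
        bilin_ext_scale_left bilin_ext_scale_right)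

lemma lookup_tensor: "lookup (tensor u v) (a, b) = lookup u a * lookup v b"
proof (induction u rule: pm_induct)
  case (single k c)
  show ?case
    by (induction v rule: pm_induct)
       (auto simp: tensor_add_right lookup_add lookup_single when_def algebra_simps)
qed (simp add: tensor_add_left lookup_add algebra_simps)

lemma lin_ext_tensor: "lin_ext (\<lambda>(a, b). f a b) (tensor u v) = bilin_ext f u v"
proof (induction u rule: pm_induct)
  case (single k c)
  show ?case
    by (induction v rule: pm_induct)
       (simp_all add: tensor_add_right lin_ext_add bilin_ext_add_right)
qed (simp add: tensor_add_left lin_ext_add bilin_ext_add_left)

lemma subspace_keys: "pm.subspace {v :: 'b \<Rightarrow>\<^sub>0 'f::field. keys v \<subseteq> S}"
proof (rule pm.subspaceI)
  fix u v :: "'b \<Rightarrow>\<^sub>0 'f" and c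
  assume "u \<in> {v. keys v \<subseteq> S}" "v \<in> {v. keys v \<subseteq> S}"
  then show "u + v \<in> {v. keys v \<subseteq> S}" using keys_add[of u v] by blast
next
  fix u :: "'b \<Rightarrow>\<^sub>0 'f" and c
  assume "u \<in> {v. keys v \<subseteq> S}"
  then show "scale c u \<in> {v. keys v \<subseteq> S}" by (auto simp: in_keys_iff)
qed simp

lemma tensor_space_keys:
  "tensor_space {u :: 'a \<Rightarrow>\<^sub>0 'f::field. keys u \<subseteq> A} {v :: 'b \<Rightarrow>\<^sub>0 'f. keys v \<subseteq> B}
    = {w. keys w \<subseteq> A \<times> B}"
proof
  show "tensor_space {u. keys u \<subseteq> A} {v. keys v \<subseteq> B} \<subseteq> {w :: _ \<Rightarrow>\<^sub>0 'f. keys w \<subseteq> A \<times> B}"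
    unfolding tensor_space_def
    by (rule pm.span_minimal[OF _ subspace_keys]) (auto simp: in_keys_iff lookup_tensor)
next
  show "{w :: _ \<Rightarrow>\<^sub>0 'f. keys w \<subseteq> A \<times> B} \<subseteq> tensor_space {u. keys u \<subseteq> A} {v. keys v \<subseteq> B}"
  proof
    fix w :: "'a \<times> 'b \<Rightarrow>\<^sub>0 'f" assume w: "w \<in> {w. keys w \<subseteq> A \<times> B}"
    have "w = (\<Sum>k\<in>keys w. single k (lookup w k))"
      by (rule poly_mapping_eqI) (simp add: lookup_sum lookup_single when_def in_keys_iff)
    moreover have "single k (lookup w k) \<in> tensor_space {u. keys u \<subseteq> A} {v. keys v \<subseteq> B}"
      if kw: "k \<in> keys w" for k
    proof -
      obtain a b where k: "k = (a, b)" "a \<in> A" "b \<in> B"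
        using kw w by (cases k) blast
      have "single k (lookup w k) = tensor (single a (lookup w k)) (single b 1)"
        by (simp add: k)
      moreover have "keys (single a (lookup w k)) \<subseteq> A" "keys (single b (1::'f)) \<subseteq> B"
        using k by auto
      ultimately show ?thesis
        unfolding tensor_space_def by (intro pm.span_base) blast
    qed
    ultimately show "w \<in> tensor_space {u. keys u \<subseteq> A} {v. keys v \<subseteq> B}"
      unfolding tensor_space_def by (metis (no_types, lifting) pm.span_sum)
  qed
qed


section \<open>Derivations into a module and first cohomology\<close>

text \<open>
  \<open>L\<close> is the carrier of a Lie algebra with bracket \<open>br\<close>, and \<open>V\<close> that of an \<open>L\<close>-module with
  action \<open>act\<close>.
\<close>

locale lie_algebra =
  fixes L :: "('a \<Rightarrow>\<^sub>0 'f::field) set" and br :: "('a \<Rightarrow>\<^sub>0 'f) \<Rightarrow> ('a \<Rightarrow>\<^sub>0 'f) \<Rightarrow> ('a \<Rightarrow>\<^sub>0 'f)"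
  assumes subspace_L: "pm.subspace L"
    and br_closed: "\<lbrakk>x \<in> L; y \<in> L\<rbrakk> \<Longrightarrow> br x y \<in> L"
    and br_add_left: "\<lbrakk>x \<in> L; y \<in> L; z \<in> L\<rbrakk> \<Longrightarrow> br (x + y) z = br x z + br y z"
    and br_add_right: "\<lbrakk>x \<in> L; y \<in> L; z \<in> L\<rbrakk> \<Longrightarrow> br x (y + z) = br x y + br x z"
    and br_scale_left: "\<lbrakk>x \<in> L; y \<in> L\<rbrakk> \<Longrightarrow> br (scale c x) y = scale c (br x y)"
    and br_scale_right: "\<lbrakk>x \<in> L; y \<in> L\<rbrakk> \<Longrightarrow> br x (scale c y) = scale c (br x y)"
    and br_alternating: "x \<in> L \<Longrightarrow> br x x = 0"
    and jacobi: "\<lbrakk>x \<in> L; y \<in> L; z \<in> L\<rbrakk> \<Longrightarrow> br x (br y z) + br y (br z x) + br z (br x y) = 0"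

locale lie_module = lie_algebra L br
  for L :: "('a \<Rightarrow>\<^sub>0 'f::field) set" and br :: "('a \<Rightarrow>\<^sub>0 'f) \<Rightarrow> ('a \<Rightarrow>\<^sub>0 'f) \<Rightarrow> ('a \<Rightarrow>\<^sub>0 'f)" +
  fixes V :: "('b \<Rightarrow>\<^sub>0 'f) set" and act :: "('a \<Rightarrow>\<^sub>0 'f) \<Rightarrow> ('b \<Rightarrow>\<^sub>0 'f) \<Rightarrow> ('b \<Rightarrow>\<^sub>0 'f)"
  assumes subspace_V: "pm.subspace V"
    and act_closed: "\<lbrakk>x \<in> L; v \<in> V\<rbrakk> \<Longrightarrow> act x v \<in> V"
    and act_add_left: "\<lbrakk>x \<in> L; y \<in> L; v \<in> V\<rbrakk> \<Longrightarrow> act (x + y) v = act x v + act y v"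
    and act_add_right: "\<lbrakk>x \<in> L; v \<in> V; w \<in> V\<rbrakk> \<Longrightarrow> act x (v + w) = act x v + act x w"
    and act_scale_left: "\<lbrakk>x \<in> L; v \<in> V\<rbrakk> \<Longrightarrow> act (scale c x) v = scale c (act x v)"
    and act_scale_right: "\<lbrakk>x \<in> L; v \<in> V\<rbrakk> \<Longrightarrow> act x (scale c v) = scale c (act x v)"
    and act_br: "\<lbrakk>x \<in> L; y \<in> L; v \<in> V\<rbrakk> \<Longrightarrow> act (br x y) v = act x (act y v) - act y (act x v)"

definition is_derivation ::
    "('a \<Rightarrow>\<^sub>0 'f::field) set \<Rightarrow> (('a \<Rightarrow>\<^sub>0 'f) \<Rightarrow> ('a \<Rightarrow>\<^sub>0 'f) \<Rightarrow> ('a \<Rightarrow>\<^sub>0 'f)) \<Rightarrow>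
     ('b \<Rightarrow>\<^sub>0 'f) set \<Rightarrow> (('a \<Rightarrow>\<^sub>0 'f) \<Rightarrow> ('b \<Rightarrow>\<^sub>0 'f) \<Rightarrow> ('b \<Rightarrow>\<^sub>0 'f)) \<Rightarrow>
     (('a \<Rightarrow>\<^sub>0 'f) \<Rightarrow> ('b \<Rightarrow>\<^sub>0 'f)) \<Rightarrow> bool" where
  "is_derivation L br V act D \<longleftrightarrow>
     (\<forall>x\<in>L. D x \<in> V) \<and>
     (\<forall>x\<in>L. \<forall>y\<in>L. D (x + y) = D x + D y) \<and>
     (\<forall>c. \<forall>x\<in>L. D (scale c x) = scale c (D x)) \<and>
     (\<forall>x\<in>L. \<forall>y\<in>L. D (br x y) = act x (D y) - act y (D x))"

definition is_inner ::
    "('a \<Rightarrow>\<^sub>0 'f::field) set \<Rightarrow> ('b \<Rightarrow>\<^sub>0 'f) set \<Rightarrow> (('a \<Rightarrow>\<^sub>0 'f) \<Rightarrow> ('b \<Rightarrow>\<^sub>0 'f) \<Rightarrow> ('b \<Rightarrow>\<^sub>0 'f)) \<Rightarrow>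
     (('a \<Rightarrow>\<^sub>0 'f) \<Rightarrow> ('b \<Rightarrow>\<^sub>0 'f)) \<Rightarrow> bool" where
  "is_inner L V act D \<longleftrightarrow> (\<exists>v\<in>V. \<forall>x\<in>L. D x = act x v)"

text \<open>
  A map \<open>L \<rightarrow> V\<close> is represented by the total function extending it by \<open>0\<close>, so that equality
  and pointwise operations in \<open>Der\<close> are those of maps on \<open>L\<close>.
\<close>

definition Der ::
    "('a \<Rightarrow>\<^sub>0 'f::field) set \<Rightarrow> (('a \<Rightarrow>\<^sub>0 'f) \<Rightarrow> ('a \<Rightarrow>\<^sub>0 'f) \<Rightarrow> ('a \<Rightarrow>\<^sub>0 'f)) \<Rightarrow>
     ('b \<Rightarrow>\<^sub>0 'f) set \<Rightarrow> (('a \<Rightarrow>\<^sub>0 'f) \<Rightarrow> ('b \<Rightarrow>\<^sub>0 'f) \<Rightarrow> ('b \<Rightarrow>\<^sub>0 'f)) \<Rightarrow>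
     (('a \<Rightarrow>\<^sub>0 'f) \<Rightarrow> ('b \<Rightarrow>\<^sub>0 'f)) set" where
  "Der L br V act = {D. is_derivation L br V act D \<and> (\<forall>x. x \<notin> L \<longrightarrow> D x = 0)}"

definition Inn ::
    "('a \<Rightarrow>\<^sub>0 'f::field) set \<Rightarrow> (('a \<Rightarrow>\<^sub>0 'f) \<Rightarrow> ('a \<Rightarrow>\<^sub>0 'f) \<Rightarrow> ('a \<Rightarrow>\<^sub>0 'f)) \<Rightarrow>
     ('b \<Rightarrow>\<^sub>0 'f) set \<Rightarrow> (('a \<Rightarrow>\<^sub>0 'f) \<Rightarrow> ('b \<Rightarrow>\<^sub>0 'f) \<Rightarrow> ('b \<Rightarrow>\<^sub>0 'f)) \<Rightarrow>
     (('a \<Rightarrow>\<^sub>0 'f) \<Rightarrow> ('b \<Rightarrow>\<^sub>0 'f)) set" where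
  "Inn L br V act = {D \<in> Der L br V act. is_inner L V act D}"

text \<open>The set of cosets of \<open>Inn\<close> in \<open>Der\<close>; its zero element is \<open>Inn\<close> itself.\<close>

definition H1 ::
    "('a \<Rightarrow>\<^sub>0 'f::field) set \<Rightarrow> (('a \<Rightarrow>\<^sub>0 'f) \<Rightarrow> ('a \<Rightarrow>\<^sub>0 'f) \<Rightarrow> ('a \<Rightarrow>\<^sub>0 'f)) \<Rightarrow>
     ('b \<Rightarrow>\<^sub>0 'f) set \<Rightarrow> (('a \<Rightarrow>\<^sub>0 'f) \<Rightarrow> ('b \<Rightarrow>\<^sub>0 'f) \<Rightarrow> ('b \<Rightarrow>\<^sub>0 'f)) \<Rightarrow>
     (('a \<Rightarrow>\<^sub>0 'f) \<Rightarrow> ('b \<Rightarrow>\<^sub>0 'f)) set set" where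
  "H1 L br V act =
     Der L br V act // {(D, E). D \<in> Der L br V act \<and> E \<in> Der L br V act \<and>
                               (\<lambda>x. D x - E x) \<in> Inn L br V act}"

context lie_module
begin

lemma inner_is_derivation:
  assumes v: "v \<in> V"
  shows "is_derivation L br V act (\<lambda>x. act x v)"
  unfolding is_derivation_def using v act_closed act_add_left act_scale_left act_br by blast

lemma zero_in_Inn: "(\<lambda>x. 0) \<in> Inn L br V act"
proof -
  have 0: "0 \<in> V" using subspace_V by (rule pm.subspace_0)
  have "act x 0 = 0" if "x \<in> L" for x
    using act_scale_right[OF that 0, of 0] by simp
  then have "is_derivation L br V act (\<lambda>x. 0)" "is_inner L V act (\<lambda>x. 0)"
    using 0 by (auto simp: is_derivation_def is_inner_def)
  then show ?thesis by (simp add: Inn_def Der_def)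
qed

lemma Inn_diff:
  assumes "D \<in> Inn L br V act" "E \<in> Inn L br V act"
  shows "(\<lambda>x. D x - E x) \<in> Inn L br V act"
proof -
  obtain v w where v: "v \<in> V" "\<And>x. x \<in> L \<Longrightarrow> D x = act x v"
    and w: "w \<in> V" "\<And>x. x \<in> L \<Longrightarrow> E x = act x w"
    using assms by (auto simp: Inn_def is_inner_def)
  have vw: "v - w \<in> V" using subspace_V v w by (simp add: pm.subspace_diff)
  have eq: "D x - E x = act x (v - w)" if "x \<in> L" for x
    using act_add_right[OF that vw w(1)] v w that by simp
  have "is_derivation L br V act (\<lambda>x. D x - E x)"
    using inner_is_derivation[OF vw] subspace_L br_closed
    by (auto simp: is_derivation_def eq pm.subspace_add pm.subspace_scale)
  then show ?thesis
    using assms vw eq by (auto simp: Inn_def Der_def is_inner_def)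
qed

lemma equiv_H1:
  "equiv (Der L br V act) {(D, E). D \<in> Der L br V act \<and> E \<in> Der L br V act \<and>
                               (\<lambda>x. D x - E x) \<in> Inn L br V act}"
proof (rule equivI)
  show "sym {(D, E). D \<in> Der L br V act \<and> E \<in> Der L br V act \<and>
                               (\<lambda>x. D x - E x) \<in> Inn L br V act}"
    using Inn_diff[OF zero_in_Inn] by (fastforce intro: symI)
  show "trans {(D, E). D \<in> Der L br V act \<and> E \<in> Der L br V act \<and>
                               (\<lambda>x. D x - E x) \<in> Inn L br V act}"
  proof (rule transI, clarsimp)
    fix D E F assume "(\<lambda>x. D x - E x) \<in> Inn L br V act" "(\<lambda>x. E x - F x) \<in> Inn L br V act"
    then show "(\<lambda>x. D x - F x) \<in> Inn L br V act"
      using Inn_diff[of "\<lambda>x. D x - E x"] Inn_diff[OF zero_in_Inn, of "\<lambda>x. E x - F x"] by fastforce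
  qed
qed (auto simp: refl_on_def zero_in_Inn)

end


section \<open>The generalized loop Virasoro algebra\<close>

definition group_algebra :: "'f::field_char_0 set \<Rightarrow> ('f \<Rightarrow>\<^sub>0 'f) set" where
  "group_algebra \<Gamma> = {f. keys f \<subseteq> \<Gamma>}"

definition partial :: "('f \<Rightarrow>\<^sub>0 'f) \<Rightarrow> ('f \<Rightarrow>\<^sub>0 'f::field_char_0)" where
  "partial = lin_ext (\<lambda>\<alpha>. single \<alpha> \<alpha>)"

text \<open>
  An element \<open>f\<partial>\<close> of \<open>W(\<Gamma>) = F[\<Gamma>]\<partial>\<close> is represented by its coefficient \<open>f\<close>; the commutator of
  the operators \<open>f\<partial>\<close> and \<open>g\<partial>\<close> is \<open>(f \<partial>(g) - g \<partial>(f))\<partial>\<close>.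
\<close>

definition witt_bracket :: "('f \<Rightarrow>\<^sub>0 'f) \<Rightarrow> ('f \<Rightarrow>\<^sub>0 'f) \<Rightarrow> ('f \<Rightarrow>\<^sub>0 'f::field_char_0)" where
  "witt_bracket f g = f * partial g - g * partial f"

text \<open>
  The Laurent polynomial ring is the group algebra \<open>int \<Rightarrow>\<^sub>0 'f\<close>, with \<open>t\<^sup>i = single i 1\<close>, and the
  bracket is the bilinear extension of \<open>[a \<otimes> t\<^sup>i, b \<otimes> t\<^sup>j] = [a, b] \<otimes> t\<^sup>i t\<^sup>j\<close>.
\<close>

definition WL :: "'f::field_char_0 set \<Rightarrow> ('f \<times> int \<Rightarrow>\<^sub>0 'f) set" where
  "WL \<Gamma> = tensor_space (group_algebra \<Gamma>) UNIV"

definition WL_bracket ::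
    "('f \<times> int \<Rightarrow>\<^sub>0 'f) \<Rightarrow> ('f \<times> int \<Rightarrow>\<^sub>0 'f) \<Rightarrow> ('f \<times> int \<Rightarrow>\<^sub>0 'f::field_char_0)" where
  "WL_bracket = bilin_ext (\<lambda>(\<alpha>, i) (\<beta>, j).
     tensor (witt_bracket (single \<alpha> 1) (single \<beta> 1)) (single i 1 * single j 1))"

definition LL :: "'f \<Rightarrow> int \<Rightarrow> ('f \<times> int \<Rightarrow>\<^sub>0 'f::field_char_0)" where
  "LL \<alpha> i = tensor (single \<alpha> 1) (single i 1)"

definition WL2 :: "'f::field_char_0 set \<Rightarrow> (('f \<times> int) \<times> ('f \<times> int) \<Rightarrow>\<^sub>0 'f) set" where
  "WL2 \<Gamma> = tensor_space (WL \<Gamma>) (WL \<Gamma>)"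

definition diag_act ::
    "('f \<times> int \<Rightarrow>\<^sub>0 'f) \<Rightarrow> (('f \<times> int) \<times> ('f \<times> int) \<Rightarrow>\<^sub>0 'f) \<Rightarrow>
     (('f \<times> int) \<times> ('f \<times> int) \<Rightarrow>\<^sub>0 'f::field_char_0)" where
  "diag_act x = lin_ext (\<lambda>(p, q). tensor (WL_bracket x (single p 1)) (single q 1)
                                  + tensor (single p 1) (WL_bracket x (single q 1)))"

lemma WL_bracket_add_left: "WL_bracket (x + x') y = WL_bracket x y + WL_bracket x' y"
  and WL_bracket_add_right: "WL_bracket x (y + y') = WL_bracket x y + WL_bracket x y'"
  and WL_bracket_scale_left: "WL_bracket (scale c x) y = scale c (WL_bracket x y)"
  and WL_bracket_scale_right: "WL_bracket x (scale c y) = scale c (WL_bracket x y)"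
  by (simp_all add: WL_bracket_def bilin_ext_add_left bilin_ext_add_right
        bilin_ext_scale_left bilin_ext_scale_right)

lemma LL_eq: "LL \<alpha> i = single (\<alpha>, i) 1"
  by (simp add: LL_def)

lemma WL_bracket_single:
  "WL_bracket (single (\<alpha>, i) c) (single (\<beta>, j) d)
     = single (\<alpha> + \<beta>, i + j) (c * d * (\<beta> - \<alpha>))"
  by (simp add: WL_bracket_def witt_bracket_def partial_def mult_single add.commute
        flip: single_diff)

lemma WL_bracket_LL: "WL_bracket (LL \<alpha> i) (LL \<beta> j) = scale (\<beta> - \<alpha>) (LL (\<alpha> + \<beta>) (i + j))"
  by (simp add: LL_eq WL_bracket_single)

lemma WL_bracket_tensor: "WL_bracket (tensor f p) (tensor g q) = tensor (witt_bracket f g) (p * q)"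
proof -
  have partial_add: "partial (u + v) = partial u + partial v" for u v :: "'a \<Rightarrow>\<^sub>0 'a"
    by (simp add: partial_def lin_ext_add)
  have witt_add_left: "witt_bracket (u + u') v = witt_bracket u v + witt_bracket u' v"
    and witt_add_right: "witt_bracket u (v + v') = witt_bracket u v + witt_bracket u v'"
    for u u' v v' :: "'a \<Rightarrow>\<^sub>0 'a"
    by (simp_all add: witt_bracket_def partial_add algebra_simps)
  have witt_single: "witt_bracket (single a c) (single b d) = single (a + b) (c * d * (b - a))"
    for a b c d :: 'a
    by (simp add: witt_bracket_def partial_def mult_single add.commute[of b a] algebra_simps
        flip: single_diff)
  show ?thesis
  proof (induction f rule: pm_induct)
    case (single a c)
    show ?case
    proof (induction g rule: pm_induct)
      case (single b d)
      show ?case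
      proof (induction p rule: pm_induct)
        case (single i e)
        show ?case
          by (induction q rule: pm_induct)
            (simp_all add: WL_bracket_single witt_single mult_single mult_ac
               tensor_add_right WL_bracket_add_right ring_distribs add.commute)
      qed (simp add: tensor_add_right WL_bracket_add_left distrib_right)
    qed (simp add: tensor_add_left WL_bracket_add_right witt_add_right)
  qed (simp add: tensor_add_left WL_bracket_add_left witt_add_left)
qed

lemma WL_eq: "WL \<Gamma> = {x. keys x \<subseteq> \<Gamma> \<times> UNIV}"
  using tensor_space_keys[of \<Gamma> UNIV] by (simp add: WL_def group_algebra_def)

lemma WL2_eq: "WL2 \<Gamma> = {v. keys v \<subseteq> (\<Gamma> \<times> UNIV) \<times> (\<Gamma> \<times> UNIV)}"
  unfolding WL2_def WL_eq by (rule tensor_space_keys)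

lemma diag_act_tensor:
  "diag_act x (tensor a b) = tensor (WL_bracket x a) b + tensor a (WL_bracket x b)"
proof (induction a rule: pm_induct)
  case (single p c)
  show ?case
  proof (induction b rule: pm_induct)
    case (single q d)
    have "WL_bracket x (single p c) = scale c (WL_bracket x (single p 1))"
      and "WL_bracket x (single q d) = scale d (WL_bracket x (single q 1))"
      and "single p c = scale c (single p 1)" and "single q d = scale d (single q 1)"
      by (simp_all flip: WL_bracket_scale_right)
    then show ?case
      by (simp add: diag_act_def tensor_scale_left tensor_scale_right pm.scale_right_distrib
          mult.commute lin_ext_scale del: scale_single)
  qed (simp add: diag_act_def tensor_add_right lin_ext_add WL_bracket_add_right)
qed (simp add: diag_act_def tensor_add_left lin_ext_add WL_bracket_add_right)

lemma diag_act_add_right: "diag_act x (v + w) = diag_act x v + diag_act x w"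
  and diag_act_scale_right: "diag_act x (scale c v) = scale c (diag_act x v)"
  by (simp_all add: diag_act_def lin_ext_add lin_ext_scale)

lemma diag_act_add_left: "diag_act (x + y) v = diag_act x v + diag_act y v"
  by (simp add: diag_act_def case_prod_unfold WL_bracket_add_left tensor_add_left tensor_add_right
      add_ac flip: lin_ext_fun_add)

lemma diag_act_scale_left: "diag_act (scale c x) v = scale c (diag_act x v)"
  by (simp add: diag_act_def case_prod_unfold WL_bracket_scale_left tensor_scale_left
      tensor_scale_right pm.scale_right_distrib flip: lin_ext_fun_scale)

lemma WL_bracket_antisym: "WL_bracket x y = - WL_bracket y x"
proof (induction x rule: pm_induct)
  case (single a c)
  show ?case
  proof (induction y rule: pm_induct)
    case (single b d)
    show ?case
      by (cases a; cases b) (simp add: WL_bracket_single add.commute algebra_simps flip: single_uminus)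
  qed (simp add: WL_bracket_add_left WL_bracket_add_right)
qed (simp add: WL_bracket_add_left WL_bracket_add_right)

lemma WL_bracket_self: "WL_bracket x x = 0"
proof (induction x rule: pm_induct)
  case (single a c)
  show ?case by (cases a) (simp add: WL_bracket_single)
next
  case (add u v)
  then show ?case
    using WL_bracket_antisym[of u v] by (simp add: WL_bracket_add_left WL_bracket_add_right)
qed

lemma WL_jacobi:
  "WL_bracket (WL_bracket x y) z = WL_bracket x (WL_bracket y z) - WL_bracket y (WL_bracket x z)"
proof (induction x rule: pm_induct)
  case (single a c)
  show ?case
  proof (induction y rule: pm_induct)
    case (single b d)
    show ?case
    proof (induction z rule: pm_induct)
      case (single k e)
      obtain \<alpha> i \<beta> j \<gamma> l where [simp]: "a = (\<alpha>, i)" "b = (\<beta>, j)" "k = (\<gamma>, l)"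
        by (cases a; cases b; cases k) auto
      have "c * d * (\<beta> - \<alpha>) * e * (\<gamma> - (\<alpha> + \<beta>))
          = c * (d * e * (\<gamma> - \<beta>)) * (\<beta> + \<gamma> - \<alpha>) - d * (c * e * (\<gamma> - \<alpha>)) * (\<alpha> + \<gamma> - \<beta>)"
        by (simp add: algebra_simps)
      then show ?case
        by (simp add: WL_bracket_single add.assoc add.left_commute[of \<beta>] add.left_commute[of j]
            single_diff)
    qed (simp add: WL_bracket_add_right)
  qed (simp add: WL_bracket_add_left WL_bracket_add_right)
qed (simp add: WL_bracket_add_left WL_bracket_add_right)

lemma diag_act_bracket:
  "diag_act (WL_bracket x y) v = diag_act x (diag_act y v) - diag_act y (diag_act x v)"
proof (induction v rule: pm_induct)
  case (single k c)
  obtain p q where [simp]: "k = (p, q)" by (cases k)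
  have k: "single k c = tensor (single p c) (single q 1)" by simp
  have tensor_diff: "tensor (u - u') w = tensor u w - tensor u' w"
    "tensor w (u - u') = tensor w u - tensor w u'" for u u' w :: "'a \<times> int \<Rightarrow>\<^sub>0 'a"
    by (metis add_diff_cancel_right' diff_add_cancel tensor_add_left)
       (metis add_diff_cancel_right' diff_add_cancel tensor_add_right)
  show ?case
    unfolding k diag_act_tensor diag_act_add_right WL_jacobi tensor_diff by simp
qed (simp add: diag_act_add_right)

lemma WL_bracket_closed:
  assumes "\<And>\<alpha> \<beta>. \<alpha> \<in> \<Gamma> \<Longrightarrow> \<beta> \<in> \<Gamma> \<Longrightarrow> \<alpha> + \<beta> \<in> \<Gamma>" and "x \<in> WL \<Gamma>" "y \<in> WL \<Gamma>"
  shows "WL_bracket x y \<in> WL \<Gamma>"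
proof -
  have sub: "pm.subspace (WL \<Gamma>)" unfolding WL_eq by (rule subspace_keys)
  have base: "tensor (witt_bracket (single \<alpha> 1) (single \<beta> 1)) (single i 1 * single j 1) \<in> WL \<Gamma>"
    if "\<alpha> \<in> \<Gamma>" "\<beta> \<in> \<Gamma>" for \<alpha> i \<beta> j
  proof -
    have "tensor (witt_bracket (single \<alpha> 1) (single \<beta> 1)) (single i 1 * single j 1)
        = single (\<alpha> + \<beta>, i + j) (\<beta> - \<alpha>)"
      using WL_bracket_tensor[of "single \<alpha> 1" "single i 1" "single \<beta> 1" "single j 1"]
      by (simp add: WL_bracket_single)
    then show ?thesis using assms(1)[OF that] by (simp add: WL_eq)
  qed
  have "(case a of (\<alpha>, i) \<Rightarrow> \<lambda>(\<beta>, j).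
      tensor (witt_bracket (single \<alpha> 1) (single \<beta> 1)) (single i 1 * single j 1)) b \<in> WL \<Gamma>"
    if "a \<in> keys x" "b \<in> keys y" for a b
    proof -
    obtain \<alpha> i \<beta> j where ab: "a = (\<alpha>, i)" "b = (\<beta>, j)" by (cases a; cases b)
    then have "\<alpha> \<in> \<Gamma>" "\<beta> \<in> \<Gamma>" using that assms(2,3) by (auto simp: WL_eq)
    then show ?thesis by (simp add: ab base)
  qed
  then show ?thesis
    unfolding WL_bracket_def bilin_ext_def lin_ext_def
    by (intro pm.subspace_sum[OF sub] pm.subspace_scale[OF sub])
qed

lemma diag_act_closed:
  assumes "\<And>\<alpha> \<beta>. \<alpha> \<in> \<Gamma> \<Longrightarrow> \<beta> \<in> \<Gamma> \<Longrightarrow> \<alpha> + \<beta> \<in> \<Gamma>" and x: "x \<in> WL \<Gamma>" and v: "v \<in> WL2 \<Gamma>"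
  shows "diag_act x v \<in> WL2 \<Gamma>"
proof -
  have sub: "pm.subspace (WL2 \<Gamma>)" unfolding WL2_eq by (rule subspace_keys)
  have tensor_closed: "tensor a b \<in> WL2 \<Gamma>" if "a \<in> WL \<Gamma>" "b \<in> WL \<Gamma>" for a b
    unfolding WL2_def tensor_space_def using that by (intro pm.span_base) blast
  have "tensor (WL_bracket x (single p 1)) (single q 1)
      + tensor (single p 1) (WL_bracket x (single q 1)) \<in> WL2 \<Gamma>" if "(p, q) \<in> keys v" for p q
  proof -
    have "single p 1 \<in> WL \<Gamma>" "single q 1 \<in> WL \<Gamma>" using that v by (auto simp: WL_eq WL2_eq)
    then show ?thesis
      by (intro pm.subspace_add[OF sub] tensor_closed WL_bracket_closed assms)
  qed
  then show ?thesis
    unfolding diag_act_def lin_ext_def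
    by (intro pm.subspace_sum[OF sub] pm.subspace_scale[OF sub]) auto
qed

lemma WL_lie_module:
  assumes "\<And>\<alpha> \<beta>. \<alpha> \<in> \<Gamma> \<Longrightarrow> \<beta> \<in> \<Gamma> \<Longrightarrow> \<alpha> + \<beta> \<in> \<Gamma>"
  shows "lie_module (WL \<Gamma>) WL_bracket (WL2 \<Gamma>) diag_act"
proof
  fix x y z
  have "WL_bracket y 0 = 0"
    using WL_bracket_scale_right[of y 0 0] by simp
  then have "WL_bracket y (WL_bracket z x) + WL_bracket y (WL_bracket x z) = 0"
    by (simp add: WL_bracket_antisym[of z x] flip: WL_bracket_add_right)
  then have "WL_bracket y (WL_bracket x z) = - WL_bracket y (WL_bracket z x)"
    by (metis add.commute eq_neg_iff_add_eq_0)
  then show "WL_bracket x (WL_bracket y z) + WL_bracket y (WL_bracket z x)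
      + WL_bracket z (WL_bracket x y) = 0"
    using WL_jacobi[of x y z] WL_bracket_antisym[of z "WL_bracket x y"] by simp
qed (simp_all add: WL_bracket_closed diag_act_closed assms WL_bracket_add_left WL_bracket_add_right
      WL_bracket_scale_left WL_bracket_scale_right WL_bracket_self diag_act_add_left
      diag_act_add_right diag_act_scale_left diag_act_scale_right diag_act_bracket,
     simp_all add: WL_eq WL2_eq subspace_keys)

end

theory Submission
  imports Defs
begin

text \<open>
  Write \<open>L\<^sub>\<beta>\<close> for \<open>LL \<beta> 0\<close>. An element \<open>v\<close> of \<open>W\<^sub>L(\<Gamma>) \<otimes> W\<^sub>L(\<Gamma>)\<close> is a finite table of coefficients
  at \<open>e\<^sup>\<alpha>\<partial>t\<^sup>k \<otimes> e\<^sup>\<delta>\<partial>t\<^sup>l\<close>, and \<open>L\<^sub>\<beta>\<close> does not move the exponents \<open>k, l\<close>. So as long as only the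
  subalgebra \<open>W(\<Gamma>) \<otimes> 1\<close> acts, the module is a direct sum of copies of \<open>W(\<Gamma>) \<otimes> W(\<Gamma>)\<close> labelled by
  \<open>(k, l)\<close>, on each of which a derivation can be treated separately. The proof makes \<open>D\<close> inner on
  \<open>W(\<Gamma>) \<otimes> 1\<close> and then shows that a derivation vanishing there vanishes everywhere.

  On \<open>W(\<Gamma>) \<otimes> 1\<close>: as \<open>L\<^sub>0\<close> multiplies weight \<open>\<alpha> + \<delta>\<close> by \<open>\<alpha> + \<delta>\<close>, subtracting an inner derivation makes
  \<open>D\<close> preserve weights (\<open>normalize_weight\<close>). For each label, \<open>D\<close> is then a family of functions
  \<open>d \<beta> :: \<Gamma> \<Rightarrow> F\<close>, giving the coefficients of \<open>D L\<^sub>\<beta>\<close> at \<open>e\<^sup>\<alpha>\<partial> \<otimes> e\<^sup>\<beta>\<^sup>-\<^sup>\<alpha>\<partial>\<close>, and the question is whether this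
  cocycle is the coboundary of one function \<open>c\<close>. Lemma \<open>cocycle_is_coboundary\<close> says yes, for
  arbitrary functions. Its idea: \<open>c\<close> can be chosen such that the difference \<open>d'\<close> of the two
  cocycles satisfies \<open>d' \<beta> \<beta> = 0\<close>, and then the cocycle identity forces \<open>E(\<beta>, \<gamma>) = d' \<beta> (\<beta> + \<gamma>) / \<beta>\<close>
  to be symmetric. For symmetric \<open>E\<close> the cocycle identity is a heavily overdetermined linear system, in which
  any three elements of \<open>\<Gamma>\<close> can be permuted; one remaining constant of \<open>c\<close> is used to get
  \<open>E(1, 1) = 0\<close>, and elimination gives \<open>E = 0\<close> (\<open>reduced_cocycle.vanishes\<close>).

  Finiteness comes for free: \<open>c \<alpha>\<close> must vanish as soon as three particular values of \<open>d 1\<close> and \<open>d 2\<close> do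
  (\<open>no_invariants_at\<close>), and only finitely many \<open>\<alpha>\<close> and labels meet the supports of \<open>D L\<^sub>1\<close> and
  \<open>D L\<^sub>2\<close>. Hence all the functions \<open>c\<close> together form one element of the module, even if \<open>\<Gamma>\<close> is not
  finitely generated.

  Finally, if \<open>D\<close> vanishes on \<open>W(\<Gamma>) \<otimes> 1\<close>, then for each \<open>i\<close> the map \<open>L\<^sub>\<beta> \<mapsto> D (LL \<beta> i)\<close> commutes with the
  action of \<open>W(\<Gamma>)\<close>, and there is no nonzero equivariant map from \<open>W(\<Gamma>)\<close> to \<open>W(\<Gamma>) \<otimes> W(\<Gamma>)\<close>
  (\<open>equivariant_map_vanishes\<close>).
\<close>

section \<open>Additive groups of scalars\<close>

locale additive_group_with_one =
  fixes \<Gamma> :: "'f::field_char_0 set"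
  assumes zero_mem: "0 \<in> \<Gamma>"
    and add_mem: "\<And>\<alpha> \<beta>. \<alpha> \<in> \<Gamma> \<Longrightarrow> \<beta> \<in> \<Gamma> \<Longrightarrow> \<alpha> + \<beta> \<in> \<Gamma>"
    and uminus_mem: "\<And>\<alpha>. \<alpha> \<in> \<Gamma> \<Longrightarrow> - \<alpha> \<in> \<Gamma>"
    and one_mem: "1 \<in> \<Gamma>"
begin

lemma diff_mem: "\<alpha> \<in> \<Gamma> \<Longrightarrow> \<beta> \<in> \<Gamma> \<Longrightarrow> \<alpha> - \<beta> \<in> \<Gamma>"
  using add_mem[of \<alpha> "- \<beta>"] uminus_mem by simp

lemma of_nat_mult_mem: "\<alpha> \<in> \<Gamma> \<Longrightarrow> of_nat n * \<alpha> \<in> \<Gamma>"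
  by (induction n) (simp_all add: zero_mem add_mem distrib_right)

lemma numeral_mult_mem: "\<alpha> \<in> \<Gamma> \<Longrightarrow> numeral n * \<alpha> \<in> \<Gamma>"
  using of_nat_mult_mem[of \<alpha> "numeral n"] by simp

lemma of_int_mem: "of_int n \<in> \<Gamma>"
  using of_nat_mult_mem[OF one_mem] uminus_mem by (cases n rule: int_cases2) auto

lemma numeral_mem: "numeral n \<in> \<Gamma>"
  using of_int_mem[of "numeral n"] by simp

lemmas mem = zero_mem one_mem add_mem uminus_mem diff_mem numeral_mem numeral_mult_mem of_int_mem

end

section \<open>Vanishing of reduced cocycles\<close>

text \<open>
  The linear algebra behind \<open>E(1, y) = 0\<close>. Here \<open>e m k\<close> stands for \<open>E(m, y + k)\<close>; \<open>integral\<close> is the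
  three-term identity of \<open>E\<close> at \<open>(m, n, y + k)\<close>, and \<open>mixed\<close> is the one at \<open>(m, y + k, n)\<close> when
  \<open>E(m, n) = 0\<close>. With indices between \<open>-2\<close> and \<open>2\<close> these are more equations than unknowns, over the
  polynomials in \<open>y\<close>. The factor \<open>y (y + 1)\<close> leaves out \<open>y = 0\<close> and \<open>y = -1\<close>, where \<open>e 1 0\<close> is itself one
  of the values of \<open>E\<close> at two integers that enter \<open>mixed\<close>.
\<close>

lemma row_elimination:
  fixes e :: "int \<Rightarrow> int \<Rightarrow> 'f::field_char_0" and y :: 'f
  assumes zero: "\<And>k. e 0 k = 0"
    and integral: "\<And>m n k. ((of_int n)^2 - (of_int m)^2) * e (m + n) k =
        of_int n * ((y + of_int k + of_int n - of_int m) * e n k - (y + of_int k + 2 * of_int m) * e n (k + m))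
      - of_int m * ((y + of_int k + of_int m - of_int n) * e m k - (y + of_int k + 2 * of_int n) * e m (k + n))"
    and mixed: "\<And>m n k. \<bar>m\<bar> \<le> 2 \<Longrightarrow> \<bar>n\<bar> \<le> 2 \<Longrightarrow> \<bar>m + n\<bar> \<le> 2 \<Longrightarrow>
      ((y + of_int k)^2 - (of_int m)^2) * e n (k + m) =
        (y + of_int k) * ((y + of_int k + of_int n - of_int m) * e n k - (of_int n + 2 * of_int m) * e (m + n) k)
      + of_int m * (of_int n + 2 * (y + of_int k)) * e m (k + n)"
  shows "y * (y + 1) * e 1 0 = 0"
proof -
  define R where "R m n k = ((of_int n)^2 - (of_int m)^2) * e (m + n) k
      - (of_int n * ((y + of_int k + of_int n - of_int m) * e n k - (y + of_int k + 2 * of_int m) * e n (k + m))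
      - of_int m * ((y + of_int k + of_int m - of_int n) * e m k - (y + of_int k + 2 * of_int n) * e m (k + n)))" for m n k
  define S where "S m k n = ((y + of_int k)^2 - (of_int m)^2) * e n (k + m) -
        ((y + of_int k) * ((y + of_int k + of_int n - of_int m) * e n k - (of_int n + 2 * of_int m) * e (m + n) k)
      + of_int m * (of_int n + 2 * (y + of_int k)) * e m (k + n))" for m k n
  have R: "R m n k = 0" for m n k using integral by (simp add: R_def)
  have S: "S m k n = 0" if "\<bar>m\<bar> \<le> 2" "\<bar>n\<bar> \<le> 2" "\<bar>m + n\<bar> \<le> 2" for m n k using mixed[OF that] by (simp add: S_def)
  \<comment> \<open>The multipliers are a short integral vector among the solutions of the linear system that
    expresses a multiple of \<open>y (y + 1) e 1 0\<close> by the equations, with polynomial multipliers of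
    degree at most 4 in \<open>y\<close>.\<close>
  have "448 * (y * (y + 1) * e 1 0) =
        (-43*y^4 + 134*y^3 - 49*y^2 - 150*y) * R (-2) 1 0
      + (-117*y^4 - 21*y^3 + 86*y^2 + 98*y + 20) * R (-2) 1 1
      + (43*y^4 - 103*y^3 + 60*y^2 + 126*y) * R (-2) 2 0
      + (83*y^4 - 91*y^3 - 84*y^2 - 24*y + 8) * R (-1) 1 (-1)
      + (93*y^4 + 48*y^3 - 107*y^2 - 104*y - 15) * R (-1) 1 0
      + (-81*y^4 - 50*y^3 - 44*y^2 - 155*y + 39) * R (-1) 1 1
      + (-75*y^4 + 42*y^3 + 13*y^2 + 44*y + 12) * R (-1) 2 (-1)
      + (63*y^4 + 30*y^3 - 105*y^2 - 96*y) * R (-1) 2 0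
      + (-37*y^4 + 5*y^3 - 93*y^2 + 261*y + 56) * S (-2) 0 1
      + (37*y^4 + 106*y^3 - 86*y^2 - 164*y - 106) * S (-2) 1 1
      + (-64*y^3 + 52*y^2 - 63*y + 75) * S (-2) 0 2
      + (8*y^3 - 14*y^2 + 78*y + 36) * S (-1) 0 (-1)
      + (-128*y^3 + 68*y^2 + 102*y + 64) * S (-1) 1 (-1)
      + (-72*y^3 + 6*y^2 + 64*y - 36) * S (-1) 2 (-1)
      + (49*y^4 + 38*y^3 - 115*y^2 + 227*y + 42) * S (-1) (-1) 1
      + (-22*y^4 + 67*y^3 + 4*y^2 + 3*y - 23) * S (-1) 0 1
      + (-27*y^4 + 23*y^3 + 7*y^2 + 344*y + 55) * S (-1) 1 1
      + (92*y^3 + 121*y^2 - 213*y - 69) * S (-1) (-1) 2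
      + (-118*y^3 + 66*y^2 + 103*y - 213) * S (-1) 0 2
      + (12*y^4 + 33*y^3 - 86*y^2 - 174*y - 62) * S 1 (-2) 1
      + (-22*y^4 + 19*y^3 + 28*y^2 - 83*y + 9) * S 1 (-1) 1
      + (10*y^4 + 28*y^3 - 96*y^2 - 57*y + 31) * S 1 0 1"
    by (simp add: R_def S_def zero) algebra
  then show ?thesis by (simp add: R S)
qed

text \<open>
  \<open>E\<close> comes from a cocycle \<open>d\<close> on \<open>W(\<Gamma>)\<close> with \<open>d \<beta> \<beta> = 0\<close> via \<open>d \<beta> (\<beta> + \<gamma>) = \<beta> E(\<beta>, \<gamma>)\<close>, and
  \<open>triple\<close> is the cocycle identity for \<open>\<beta>, \<gamma>\<close> at \<open>\<alpha> = \<beta> + \<gamma> + z\<close>. Since \<open>E\<close> is symmetric, all values in it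
  are among the six at the pairs \<open>{\<beta>, \<gamma>}, {\<gamma>, z}, {z, \<beta>}\<close> and \<open>{\<beta> + \<gamma>, z}, {\<gamma> + z, \<beta>}, {z + \<beta>, \<gamma>}\<close>, so
  permuting \<open>\<beta>, \<gamma>, z\<close> gives further equations between the same values. A nonzero constant, set to \<open>0\<close> where
  \<open>\<beta> = 0\<close>, \<open>\<gamma> = 0\<close> or \<open>\<beta> + \<gamma> = 0\<close>, also satisfies all conditions; this is why \<open>E(1, 1) = 0\<close> is needed below.
\<close>

locale reduced_cocycle = additive_group_with_one \<Gamma> for \<Gamma> :: "'f::field_char_0 set" +
  fixes E :: "'f \<Rightarrow> 'f \<Rightarrow> 'f"
  assumes sym: "\<And>\<beta> \<gamma>. \<beta> \<in> \<Gamma> \<Longrightarrow> \<gamma> \<in> \<Gamma> \<Longrightarrow> E \<beta> \<gamma> = E \<gamma> \<beta>"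
    and zero_left: "\<And>\<gamma>. \<gamma> \<in> \<Gamma> \<Longrightarrow> E 0 \<gamma> = 0"
    and triple: "\<And>\<beta> \<gamma> z. \<beta> \<in> \<Gamma> \<Longrightarrow> \<gamma> \<in> \<Gamma> \<Longrightarrow> z \<in> \<Gamma> \<Longrightarrow>
      (\<gamma>^2 - \<beta>^2) * E (\<beta> + \<gamma>) z =
        \<gamma> * ((z + \<gamma> - \<beta>) * E \<gamma> z - (z + 2 * \<beta>) * E \<gamma> (z + \<beta>))
      - \<beta> * ((z + \<beta> - \<gamma>) * E \<beta> z - (z + 2 * \<gamma>) * E \<beta> (z + \<gamma>))"
begin

lemma zero_right: "\<gamma> \<in> \<Gamma> \<Longrightarrow> E \<gamma> 0 = 0"
  using sym zero_left zero_mem by metis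

text \<open>
  The identity is homogeneous of degree 2 in \<open>\<beta>, \<gamma>, z\<close>, so everything shown for \<open>E(1, \<cdot>)\<close> carries
  over to \<open>E(\<beta>, \<cdot>)\<close>.
\<close>

lemma rescale:
  assumes \<beta>: "\<beta> \<in> \<Gamma>" "\<beta> \<noteq> 0"
  shows "reduced_cocycle {x. \<beta> * x \<in> \<Gamma>} (\<lambda>x y. E (\<beta> * x) (\<beta> * y))"
proof
  fix x y z assume "x \<in> {x. \<beta> * x \<in> \<Gamma>}" "y \<in> {x. \<beta> * x \<in> \<Gamma>}" "z \<in> {x. \<beta> * x \<in> \<Gamma>}"
  then have "((\<beta> * y)^2 - (\<beta> * x)^2) * E (\<beta> * (x + y)) (\<beta> * z) =
      \<beta> * y * ((\<beta> * z + \<beta> * y - \<beta> * x) * E (\<beta> * y) (\<beta> * z) - (\<beta> * z + 2 * (\<beta> * x)) * E (\<beta> * y) (\<beta> * (z + x)))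
      - \<beta> * x * ((\<beta> * z + \<beta> * x - \<beta> * y) * E (\<beta> * x) (\<beta> * z) - (\<beta> * z + 2 * (\<beta> * y)) * E (\<beta> * x) (\<beta> * (z + y)))"
    using triple[of "\<beta> * x" "\<beta> * y" "\<beta> * z"] by (simp add: distrib_left)
  then have "\<beta>^2 * ((y^2 - x^2) * E (\<beta> * (x + y)) (\<beta> * z)) =
      \<beta>^2 * (y * ((z + y - x) * E (\<beta> * y) (\<beta> * z) - (z + 2 * x) * E (\<beta> * y) (\<beta> * (z + x)))
      - x * ((z + x - y) * E (\<beta> * x) (\<beta> * z) - (z + 2 * y) * E (\<beta> * x) (\<beta> * (z + y))))"
    by (simp add: algebra_simps power2_eq_square)
  then show "(y^2 - x^2) * E (\<beta> * (x + y)) (\<beta> * z) =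
      y * ((z + y - x) * E (\<beta> * y) (\<beta> * z) - (z + 2 * x) * E (\<beta> * y) (\<beta> * (z + x)))
      - x * ((z + x - y) * E (\<beta> * x) (\<beta> * z) - (z + 2 * y) * E (\<beta> * x) (\<beta> * (z + y)))"
    using \<beta> by simp
qed (use \<beta> in \<open>auto simp: distrib_left zero_left intro: mem sym\<close>)

text \<open>
  Eight instances of the identity form a linear system with nonzero determinant for the eight values
  of \<open>E\<close> named in the proof. Five of these values are the ones needed for \<open>mixed\<close> in
  \<open>row_elimination\<close>.
\<close>

lemma integer_values:
  assumes "E 1 1 = 0"
  shows "E 1 (-1) = 0" "E (-1) (-1) = 0" "E 1 (-2) = 0" "E 2 (-1) = 0" "E 2 (-2) = 0"
proof -
  define u q r s p w v t where "u = E 1 (-1)" and "q = E 2 (-1)" and "r = E 3 (-1)" and "s = E 2 1"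
    and "p = E 1 (-2)" and "w = E (-1) (-1)" and "v = E 2 (-2)" and "t = E 3 (-2)"
  note defs = this
  have m: "-1 \<in> \<Gamma>" "-2 \<in> \<Gamma>" using mem by auto
  have "E (-1) 1 = u" "E (-1) 2 = q" "E (-1) 3 = r" "E 1 2 = s" "E (-2) 1 = p" "E (-2) 2 = v" "E (-2) 3 = t"
    unfolding defs using sym m mem by metis+
  note [simp] = this defs[symmetric] assms zero_left zero_right mem
  have 1: "u = -3 * q" using triple[of "-1" 1 1] by simp
  have 2: "r = s" using triple[of "-1" 1 2] by simp
  have 3: "2 * u = 3 * r" using triple[of 1 2 "-1"] by simp
  have 4: "2 * p + 3 * v = 3 * u" using triple[of "-2" 1 1] by simp algebra
  have 5: "3 * p + u = 3 * w" using triple[of "-1" 1 "-1"] by simp algebra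
  have 6: "3 * v + 2 * q = 2 * w + 3 * u" using triple[of "-1" 2 "-1"] by simp algebra
  have 7: "3 * p = 2 * v + 3 * t" using triple[of 1 2 "-2"] by simp
  have 8: "2 * v + 8 * t = 3 * q + 5 * s" using triple[of "-2" 1 2] by simp algebra
  have "245 * u = 0" using 1 2 3 4 5 6 7 8 by algebra
  then have u: "u = 0" by simp
  then have q: "q = 0" using 1 by simp
  have "4 * p = 0" using 1 4 5 6 u by algebra
  then have p: "p = 0" by simp
  have w: "w = 0" using 5 u p by simp
  have v: "v = 0" using 4 u p by simp
  show "E 1 (-1) = 0" "E (-1) (-1) = 0" "E 1 (-2) = 0" "E 2 (-1) = 0" "E 2 (-2) = 0"
    by (simp_all add: u w p q v)
qed

lemma row_one:
  assumes 11: "E 1 1 = 0" and y: "y \<in> \<Gamma>"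
  shows "E 1 y = 0"
proof -
  define e where "e m k = E (of_int m) (y + of_int k)" for m k
  have int: "E (of_int m) (of_int n) = 0" if "\<bar>m\<bar> \<le> 2" "\<bar>n\<bar> \<le> 2" "\<bar>m + n\<bar> \<le> 2" for m n
  proof -
    have "m \<in> {-2..2}" "n \<in> {-2..2}" using that by auto
    moreover have "{-2..2::int} = {-2, -1, 0, 1, 2}" by auto
    ultimately have m: "m = -2 \<or> m = -1 \<or> m = 0 \<or> m = 1 \<or> m = 2"
      and n: "n = -2 \<or> n = -1 \<or> n = 0 \<or> n = 1 \<or> n = 2" by auto
    have "-1 \<in> \<Gamma>" "-2 \<in> \<Gamma>" using mem by auto
    then have s: "E (-1) 1 = E 1 (-1)" "E (-1) 2 = E 2 (-1)" "E (-2) 1 = E 1 (-2)" "E (-2) 2 = E 2 (-2)"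
      using sym mem by metis+
    show ?thesis using m n that(3) by (elim disjE) (simp_all add: zero_left zero_right mem integer_values[OF 11] s 11)
  qed
  have "y * (y + 1) * e 1 0 = 0"
  proof (rule row_elimination)
    show "e 0 k = 0" for k by (simp add: e_def zero_left mem y)
    show "((of_int n)^2 - (of_int m)^2) * e (m + n) k =
        of_int n * ((y + of_int k + of_int n - of_int m) * e n k - (y + of_int k + 2 * of_int m) * e n (k + m))
      - of_int m * ((y + of_int k + of_int m - of_int n) * e m k - (y + of_int k + 2 * of_int n) * e m (k + n))" for m n k
      using triple[of "of_int m" "of_int n" "y + of_int k"] by (simp add: e_def mem y add.assoc)
    show "((y + of_int k)^2 - (of_int m)^2) * e n (k + m) =
        (y + of_int k) * ((y + of_int k + of_int n - of_int m) * e n k - (of_int n + 2 * of_int m) * e (m + n) k)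
      + of_int m * (of_int n + 2 * (y + of_int k)) * e m (k + n)"
      if "\<bar>m\<bar> \<le> 2" "\<bar>n\<bar> \<le> 2" "\<bar>m + n\<bar> \<le> 2" for m n k
    proof -
      have "E (y + of_int j) (of_int i) = e i j" for i j by (simp add: e_def sym mem y)
      moreover have "E (of_int m + (y + of_int k)) (of_int n) = e n (k + m)"
        using sym[of "of_int n" "of_int m + (y + of_int k)"] by (simp add: e_def mem y ac_simps)
      moreover have "E (y + of_int k) (of_int n + of_int m) = e (m + n) k"
        using sym[of "of_int n + of_int m" "y + of_int k"] by (simp add: e_def mem y ac_simps)
      moreover have "E (of_int m) (of_int n + (y + of_int k)) = e m (k + n)"
        by (simp add: e_def ac_simps)
      ultimately show ?thesis
        using triple[of "of_int m" "y + of_int k" "of_int n"] int[OF that] y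
        by (simp add: mem algebra_simps)
    qed
  qed
  then have "y = 0 \<or> y = -1 \<or> E 1 y = 0" by (auto simp: e_def eq_neg_iff_add_eq_0)
  then show ?thesis using zero_right integer_values[OF 11] mem by auto
qed

lemma row:
  assumes \<beta>: "\<beta> \<in> \<Gamma>" "E \<beta> \<beta> = 0" and y: "y \<in> \<Gamma>"
  shows "E \<beta> y = 0"
proof (cases "\<beta> = 0")
  case False
  interpret r: reduced_cocycle "{x. \<beta> * x \<in> \<Gamma>}" "\<lambda>x y. E (\<beta> * x) (\<beta> * y)"
    by (rule rescale[OF \<beta>(1) False])
  show ?thesis using r.row_one[of "y / \<beta>"] \<beta> y False by simp
qed (simp add: zero_left y)

text \<open>
  Once \<open>E(s, \<cdot>) = 0\<close> for \<open>s = 1\<close> and \<open>s = -1\<close>, three instances of the identity connect \<open>E(y, y)\<close> with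
  \<open>E(y - s, y + s)\<close> and \<open>E(y - s, y)\<close>. Eliminating the last two leaves \<open>y (3 y + s) E(y, y) = 0\<close>, and
  the factors \<open>3 y + 1\<close> and \<open>3 y - 1\<close> are not both zero.
\<close>

lemma diagonal:
  assumes 11: "E 1 1 = 0" and y: "y \<in> \<Gamma>"
  shows "E y y = 0"
proof -
  have r: "E s x = 0" if "s = 1 \<or> s = -1" "x \<in> \<Gamma>" for s x
    using that row[of s x] 11 integer_values(2)[OF 11] mem by auto
  have *: "y * (3 * y + s) * E y y = 0" if s: "s = 1 \<or> s = -1" for s
  proof -
    define h k f where "h = E (y - s) (y + s)" and "k = E (y - s) y" and "f = E y y"
    have [simp]: "s^2 = 1" using s by auto
    have m: "s \<in> \<Gamma>" "-s \<in> \<Gamma>" "- s = 1 \<or> - s = -1" using s mem by auto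
    have "((y - s)^2 - s^2) * E (s + (y - s)) y =
        (y - s) * ((y + (y - s) - s) * E (y - s) y - (y + 2 * s) * E (y - s) (y + s))"
      using triple[of s "y - s" y] r[OF s] by (simp add: mem m y)
    then have 1: "((y - s)^2 - s^2) * f = (y - s) * ((y + (y - s) - s) * k - (y + 2 * s) * h)"
      by (simp add: f_def k_def h_def)
    have "(y^2 - s^2) * E (s + y) (y - s) =
        y * ((y - s + y - s) * E y (y - s) - (y - s + 2 * s) * E y (y - s + s))"
      using triple[of s y "y - s"] r[OF s] by (simp add: mem m y)
    then have 2: "(y^2 - s^2) * h = y * ((y - s + y - s) * k - (y - s + 2 * s) * f)"
      using sym[of "s + y" "y - s"] sym[of y "y - s"] m y
      by (simp add: f_def k_def h_def mem add.commute)
    have "(y^2 - s^2) * E (- s + y) y = y * ((y + y - (- s)) * E y y - (y + 2 * - s) * E y (y + - s))"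
      using triple[of "- s" y y] r[OF m(3)] by (simp add: mem m y)
    then have 3: "(y^2 - s^2) * k = y * ((y + y + s) * f - (y - 2 * s) * k)"
      using sym[of y "y - s"] m y by (simp add: f_def k_def mem)
    have 4: "(y - s) * (2 * y + s) * k = 2 * y * (y + s) * f"
    proof -
      have "2 * s * ((y - s) * (2 * y + s) * k) = 2 * s * (2 * y * (y + s) * f)" using 1 2 by algebra
      moreover have "2 * s \<noteq> 0" using s by auto
      ultimately show ?thesis by (metis mult_left_cancel)
    qed
    have 5: "y * (2 * y + s) * f = (2 * y^2 - 2 * s * y - s^2) * k"
      using 3 by (simp add: algebra_simps power2_eq_square)
    have "(y - s) * (2 * y + s) * (y * (2 * y + s) * f) = (2 * y^2 - 2 * s * y - s^2) * ((y - s) * (2 * y + s) * k)"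
      unfolding 5 by (simp add: mult_ac)
    then have "s^2 * (y * (3 * y + s) * f) = 0"
      unfolding 4 by (simp add: algebra_simps power2_eq_square)
    then have "y * (3 * y + s) * f = 0" by simp
    then show ?thesis by (simp add: f_def)
  qed
  have "y = 0 \<or> (3 * y + 1 = 0 \<and> 3 * y - 1 = 0) \<or> E y y = 0"
    using *[of 1] *[of "-1"] by auto
  moreover have False if "3 * y + 1 = 0" "3 * y - 1 = 0"
  proof -
    have "(2::'f) = 0" using that by algebra
    then show False by simp
  qed
  ultimately show ?thesis using zero_left[OF zero_mem] by auto
qed

lemma vanishes:
  assumes "E 1 1 = 0" "\<beta> \<in> \<Gamma>" "\<gamma> \<in> \<Gamma>"
  shows "E \<beta> \<gamma> = 0"
  by (rule row[OF assms(2) diagonal[OF assms(1,2)] assms(3)])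

end

section \<open>Weight-preserving cocycles of \<open>W(\<Gamma>)\<close>\<close>

text \<open>
  If \<open>c\<close> takes the values \<open>x, y, z\<close> at \<open>\<alpha>, \<alpha> - 1, \<alpha> - 2\<close>, the hypotheses say that the coefficients of
  \<open>L\<^sub>1 c\<close> at \<open>\<alpha>\<close> and \<open>\<alpha> - 1\<close> and of \<open>L\<^sub>2 c\<close> at \<open>\<alpha>\<close> vanish. The first two equations alone are
  solved by the function \<open>1 / ((\<alpha> + 1) \<alpha> (\<alpha> - 1))\<close>, which \<open>L\<^sub>2\<close> excludes. The conclusion is local in \<open>\<alpha>\<close> and thus
  bounds the support of \<open>c\<close> by those of \<open>L\<^sub>1 c\<close> and \<open>L\<^sub>2 c\<close>.
\<close>

lemma no_invariants_at:
  fixes \<alpha> x y z :: "'f::field_char_0"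
  assumes "(\<alpha> - 2) * y = (\<alpha> + 1) * x" "(\<alpha> - 3) * z = \<alpha> * y" "(\<alpha> - 4) * z = (\<alpha> + 2) * x"
  shows "x = 0"
proof -
  have "12 * x = (\<alpha> - 4) * ((\<alpha> - 2) * ((\<alpha> - 3) * z - \<alpha> * y) + \<alpha> * ((\<alpha> - 2) * y - (\<alpha> + 1) * x))
      - (\<alpha> - 2) * (\<alpha> - 3) * ((\<alpha> - 4) * z - (\<alpha> + 2) * x)"
    by algebra
  then show ?thesis by (simp add: assms)
qed

context additive_group_with_one
begin

text \<open>
  \<open>d \<beta> \<alpha>\<close> is the coefficient of \<open>D L\<^sub>\<beta>\<close> at \<open>e\<^sup>\<alpha>\<partial> \<otimes> e\<^sup>\<beta>\<^sup>-\<^sup>\<alpha>\<partial>\<close>, and the right-hand side of the conclusion is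
  the corresponding coefficient of \<open>L\<^sub>\<beta>\<close> acting on the (possibly infinite) sum of the
  \<open>c \<alpha> e\<^sup>\<alpha>\<partial> \<otimes> e\<^sup>-\<^sup>\<alpha>\<partial>\<close>. At \<open>\<alpha> = \<beta>\<close> it reads \<open>- \<beta> c 0 - 2 \<beta> c \<beta>\<close>, which determines \<open>c \<beta>\<close> for every
  \<open>\<beta> \<noteq> 0\<close> once \<open>c 0\<close> is chosen; at \<open>\<beta> = 1\<close>, \<open>\<alpha> = 2\<close> it reads \<open>- 3 c 2\<close>, which determines \<open>c 0\<close>.
\<close>

lemma cocycle_is_coboundary:
  fixes d :: "'f \<Rightarrow> 'f \<Rightarrow> 'f"
  assumes cocycle: "\<And>\<beta> \<gamma> \<alpha>. \<beta> \<in> \<Gamma> \<Longrightarrow> \<gamma> \<in> \<Gamma> \<Longrightarrow> \<alpha> \<in> \<Gamma> \<Longrightarrow>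
      (\<gamma> - \<beta>) * d (\<beta> + \<gamma>) \<alpha> =
        ((\<alpha> - 2 * \<beta>) * d \<gamma> (\<alpha> - \<beta>) + (\<gamma> - \<alpha> - \<beta>) * d \<gamma> \<alpha>)
      - ((\<alpha> - 2 * \<gamma>) * d \<beta> (\<alpha> - \<gamma>) + (\<beta> - \<alpha> - \<gamma>) * d \<beta> \<alpha>)"
    and zero: "\<And>\<alpha>. \<alpha> \<in> \<Gamma> \<Longrightarrow> d 0 \<alpha> = 0"
  obtains c where
    "\<And>\<beta> \<alpha>. \<beta> \<in> \<Gamma> \<Longrightarrow> \<alpha> \<in> \<Gamma> \<Longrightarrow> d \<beta> \<alpha> = (\<alpha> - 2 * \<beta>) * c (\<alpha> - \<beta>) - (\<alpha> + \<beta>) * c \<alpha>"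
proof
  define c0 where "c0 = 2 * d 1 2 / 3 - d 2 2 / 2"
  define c where "c \<beta> = (if \<beta> = 0 then c0 else - (d \<beta> \<beta> / \<beta> + c0) / 2)" for \<beta>
  define d' where "d' \<beta> \<alpha> = d \<beta> \<alpha> - ((\<alpha> - 2 * \<beta>) * c (\<alpha> - \<beta>) - (\<alpha> + \<beta>) * c \<alpha>)" for \<beta> \<alpha>
  define E where "E \<beta> \<gamma> = (if \<beta> = 0 then 0 else d' \<beta> (\<beta> + \<gamma>) / \<beta>)" for \<beta> \<gamma>
  have d'_zero: "d' 0 \<alpha> = 0" if "\<alpha> \<in> \<Gamma>" for \<alpha>
    using zero[OF that] by (simp add: d'_def)
  have d'_diag: "d' \<beta> \<beta> = 0" for \<beta>
    by (cases "\<beta> = 0") (simp_all add: d'_def c_def zero zero_mem field_simps)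
  have d'_E: "d' \<beta> (\<beta> + \<gamma>) = \<beta> * E \<beta> \<gamma>" if "\<beta> \<in> \<Gamma>" "\<gamma> \<in> \<Gamma>" for \<beta> \<gamma>
    using d'_zero that by (simp add: E_def)
  have d'_cocycle: "(\<gamma> - \<beta>) * d' (\<beta> + \<gamma>) \<alpha> =
        ((\<alpha> - 2 * \<beta>) * d' \<gamma> (\<alpha> - \<beta>) + (\<gamma> - \<alpha> - \<beta>) * d' \<gamma> \<alpha>)
      - ((\<alpha> - 2 * \<gamma>) * d' \<beta> (\<alpha> - \<gamma>) + (\<beta> - \<alpha> - \<gamma>) * d' \<beta> \<alpha>)"
    if "\<beta> \<in> \<Gamma>" "\<gamma> \<in> \<Gamma>" "\<alpha> \<in> \<Gamma>" for \<beta> \<gamma> \<alpha>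
  proof -
    have a: "\<alpha> - \<beta> - \<gamma> = \<alpha> - (\<beta> + \<gamma>)" "\<alpha> - \<gamma> - \<beta> = \<alpha> - (\<beta> + \<gamma>)" by simp_all
    have "((\<alpha> - 2 * \<beta>) * ((\<alpha> - \<beta> - 2 * \<gamma>) * r - (\<alpha> - \<beta> + \<gamma>) * p)
          + (\<gamma> - \<alpha> - \<beta>) * ((\<alpha> - 2 * \<gamma>) * q - (\<alpha> + \<gamma>) * s))
        - ((\<alpha> - 2 * \<gamma>) * ((\<alpha> - \<gamma> - 2 * \<beta>) * r - (\<alpha> - \<gamma> + \<beta>) * q)
          + (\<beta> - \<alpha> - \<gamma>) * ((\<alpha> - 2 * \<beta>) * p - (\<alpha> + \<beta>) * s))
        = (\<gamma> - \<beta>) * ((\<alpha> - 2 * (\<beta> + \<gamma>)) * r - (\<alpha> + (\<beta> + \<gamma>)) * s)" for p q r s :: 'f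
      by algebra
    from this[of "c (\<alpha> - (\<beta> + \<gamma>))" "c (\<alpha> - \<beta>)" "c (\<alpha> - \<gamma>)" "c \<alpha>"]
    show ?thesis unfolding d'_def a using cocycle[OF that] by (simp add: algebra_simps)
  qed
  interpret reduced_cocycle \<Gamma> E
  proof
    show "E 0 \<gamma> = 0" for \<gamma> by (simp add: E_def)
    show "E \<beta> \<gamma> = E \<gamma> \<beta>" if m: "\<beta> \<in> \<Gamma>" "\<gamma> \<in> \<Gamma>" for \<beta> \<gamma>
    proof (cases "\<beta> = 0 \<or> \<gamma> = 0")
      case False
      \<comment> \<open>At \<open>\<alpha> = \<beta> + \<gamma>\<close> the other three terms are values \<open>d' x x\<close>.\<close>
      have "\<beta> * d' \<gamma> (\<beta> + \<gamma>) = \<gamma> * d' \<beta> (\<beta> + \<gamma>)"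
        using d'_cocycle[OF m add_mem[OF m]] by (simp add: d'_diag algebra_simps)
      then show ?thesis using False by (simp add: E_def field_simps add.commute)
    qed (auto simp: d'_diag E_def)
    show "(\<gamma>^2 - \<beta>^2) * E (\<beta> + \<gamma>) z =
        \<gamma> * ((z + \<gamma> - \<beta>) * E \<gamma> z - (z + 2 * \<beta>) * E \<gamma> (z + \<beta>))
      - \<beta> * ((z + \<beta> - \<gamma>) * E \<beta> z - (z + 2 * \<gamma>) * E \<beta> (z + \<gamma>))"
      if m: "\<beta> \<in> \<Gamma>" "\<gamma> \<in> \<Gamma>" "z \<in> \<Gamma>" for \<beta> \<gamma> z
    proof -
      have e: "d' (\<beta> + \<gamma>) (\<beta> + \<gamma> + z) = (\<beta> + \<gamma>) * E (\<beta> + \<gamma>) z"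
        "d' \<gamma> (\<beta> + \<gamma> + z) = \<gamma> * E \<gamma> (z + \<beta>)" "d' \<beta> (\<beta> + \<gamma> + z) = \<beta> * E \<beta> (z + \<gamma>)"
        "d' \<gamma> (\<beta> + \<gamma> + z - \<beta>) = \<gamma> * E \<gamma> z" "d' \<beta> (\<beta> + \<gamma> + z - \<gamma>) = \<beta> * E \<beta> z"
        using d'_E[of "\<beta> + \<gamma>" z] d'_E[of \<gamma> "z + \<beta>"] d'_E[of \<beta> "z + \<gamma>"] d'_E[of \<gamma> z] d'_E[of \<beta> z] m
        by (simp_all add: add_mem ac_simps)
      have "(\<gamma> - \<beta>) * ((\<beta> + \<gamma>) * A) =
        ((\<beta> + \<gamma> + z - 2 * \<beta>) * (\<gamma> * q) + (\<gamma> - (\<beta> + \<gamma> + z) - \<beta>) * (\<gamma> * C))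
        - ((\<beta> + \<gamma> + z - 2 * \<gamma>) * (\<beta> * r) + (\<beta> - (\<beta> + \<gamma> + z) - \<gamma>) * (\<beta> * B)) \<Longrightarrow>
        (\<gamma>^2 - \<beta>^2) * A = \<gamma> * ((z + \<gamma> - \<beta>) * q - (z + 2 * \<beta>) * C) - \<beta> * ((z + \<beta> - \<gamma>) * r - (z + 2 * \<gamma>) * B)"
        for A B C q r :: 'f
        by algebra
      then show ?thesis using d'_cocycle[of \<beta> \<gamma> "\<beta> + \<gamma> + z"] m unfolding e by (simp add: add_mem)
    qed
  qed
  have "E 1 1 = 0" by (simp add: E_def d'_def c_def c0_def field_simps)
  then have "d' \<beta> \<alpha> = 0" if "\<beta> \<in> \<Gamma>" "\<alpha> \<in> \<Gamma>" for \<beta> \<alpha>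
    using vanishes[of \<beta> "\<alpha> - \<beta>"] d'_E[of \<beta> "\<alpha> - \<beta>"] that by (simp add: diff_mem)
  then show "d \<beta> \<alpha> = (\<alpha> - 2 * \<beta>) * c (\<alpha> - \<beta>) - (\<alpha> + \<beta>) * c \<alpha>" if "\<beta> \<in> \<Gamma>" "\<alpha> \<in> \<Gamma>" for \<beta> \<alpha>
    using that by (simp add: d'_def)
qed

text \<open>
  By equivariance everything is determined by the image \<open>e 0\<close> of \<open>L\<^sub>0\<close>, and \<open>[L\<^sub>\<beta>, L\<^sub>\<beta>] = 0\<close> gives
  \<open>L\<^sub>\<beta> L\<^sub>\<beta> (e 0) = 0\<close>. The coefficients in these equations have enough zeros to kill \<open>e 0\<close> first on
  \<open>2 \<Gamma>\<close> (away from \<open>0\<close>), then on all of \<open>\<Gamma>\<close>.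
\<close>

lemma equivariant_map_vanishes:
  fixes e :: "'f \<Rightarrow> 'f \<Rightarrow> 'f"
  assumes equivariant: "\<And>\<beta> \<gamma> \<alpha>. \<beta> \<in> \<Gamma> \<Longrightarrow> \<gamma> \<in> \<Gamma> \<Longrightarrow> \<alpha> \<in> \<Gamma> \<Longrightarrow>
      (\<gamma> - \<beta>) * e (\<beta> + \<gamma>) \<alpha> = (\<alpha> - 2 * \<beta>) * e \<gamma> (\<alpha> - \<beta>) + (\<gamma> - \<alpha> - \<beta>) * e \<gamma> \<alpha>"
    and "\<beta> \<in> \<Gamma>" "\<alpha> \<in> \<Gamma>"
  shows "e \<beta> \<alpha> = 0"
proof -
  have act: "- \<beta> * e \<beta> \<alpha> = (\<alpha> - 2 * \<beta>) * e 0 (\<alpha> - \<beta>) - (\<alpha> + \<beta>) * e 0 \<alpha>"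
    if "\<beta> \<in> \<Gamma>" "\<alpha> \<in> \<Gamma>" for \<beta> \<alpha>
    using equivariant[of \<beta> 0 \<alpha>] that by (simp add: zero_mem algebra_simps)
  have self: "(\<alpha> - 2 * \<beta>) * e \<beta> (\<alpha> - \<beta>) = \<alpha> * e \<beta> \<alpha>" if "\<beta> \<in> \<Gamma>" "\<alpha> \<in> \<Gamma>" for \<beta> \<alpha>
    using equivariant[of \<beta> \<beta> \<alpha>] that by simp
  have double: "e 0 (2 * \<beta>) = 0" if "\<beta> \<in> \<Gamma>" "\<beta> \<noteq> 0" for \<beta>
    using self[of \<beta> "2 * \<beta>"] act[of \<beta> "2 * \<beta>"] that by (simp add: mem)
  have nonzero: "e 0 \<alpha> = 0" if \<alpha>: "\<alpha> \<in> \<Gamma>" "\<alpha> \<noteq> 0" for \<alpha>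
  proof -
    \<comment> \<open>Steps of length \<open>3 \<alpha>\<close> connect \<open>\<alpha>\<close> with \<open>4 \<alpha>\<close> and \<open>- 2 \<alpha>\<close>, which both lie in \<open>2 \<Gamma>\<close>.\<close>
    have "e 0 (4 * \<alpha>) = 0" "e 0 (- 2 * \<alpha>) = 0"
      using double[of "2 * \<alpha>"] double[of "- \<alpha>"] \<alpha> by (simp_all add: mem)
    then have "3 * \<alpha> * e (3 * \<alpha>) (4 * \<alpha>) = 2 * \<alpha> * e 0 \<alpha>" "3 * \<alpha> * e (3 * \<alpha>) \<alpha> = 4 * \<alpha> * e 0 \<alpha>"
      using act[of "3 * \<alpha>" "4 * \<alpha>"] act[of "3 * \<alpha>" \<alpha>] \<alpha> by (simp_all add: mem)
    then have "3 * e (3 * \<alpha>) (4 * \<alpha>) = 2 * e 0 \<alpha>" "3 * e (3 * \<alpha>) \<alpha> = 4 * e 0 \<alpha>"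
      using \<alpha>(2) by simp_all
    moreover have "- 2 * e (3 * \<alpha>) \<alpha> = 4 * e (3 * \<alpha>) (4 * \<alpha>)"
    proof -
      have eqs: "4 * \<alpha> - 2 * (3 * \<alpha>) = \<alpha> * - 2" "4 * \<alpha> - 3 * \<alpha> = \<alpha>" by simp_all
      have "(4 * \<alpha> - 2 * (3 * \<alpha>)) * e (3 * \<alpha>) (4 * \<alpha> - 3 * \<alpha>) = 4 * \<alpha> * e (3 * \<alpha>) (4 * \<alpha>)"
        using \<alpha> by (intro self numeral_mult_mem)
      then have "\<alpha> * (- 2 * e (3 * \<alpha>) \<alpha>) = \<alpha> * (4 * e (3 * \<alpha>) (4 * \<alpha>))"
        unfolding eqs by (simp only: mult_ac)
      then show ?thesis by (rule mult_left_cancel[OF \<alpha>(2), THEN iffD1])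
    qed
    moreover have "16 * z = 0" if "3 * p = 2 * z" "3 * q = 4 * z" "- 2 * q = 4 * p" for p q z :: 'f
      using that by algebra
    ultimately have "16 * e 0 \<alpha> = 0" by blast
    then show ?thesis by simp
  qed
  have "e 0 0 = 0"
    using act[of 1 0] act[of 1 1] self[of 1 1] nonzero[of 1] nonzero[of "-1"] by (simp add: mem)
  then have zero: "e 0 \<alpha> = 0" if "\<alpha> \<in> \<Gamma>" for \<alpha> using nonzero that by blast
  show ?thesis
  proof (cases "\<beta> = 0")
    case False
    then show ?thesis using act[of \<beta> \<alpha>] zero assms(2,3) by (simp add: diff_mem)
  qed (simp add: zero assms(3))
qed

end

section \<open>Derivations of the loop algebra\<close>

lemma lookup_diag_act_LL:
  "lookup (diag_act (LL \<beta> j) v) ((\<alpha>, k), (\<delta>, l)) =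
    (\<alpha> - 2 * \<beta>) * lookup v ((\<alpha> - \<beta>, k - j), (\<delta>, l)) + (\<delta> - 2 * \<beta>) * lookup v ((\<alpha>, k), (\<delta> - \<beta>, l - j))"
proof (induction v rule: pm_induct)
  case (single p c)
  obtain a m b n where p: "p = ((a, m), (b, n))" by (metis surj_pair)
  have "single p c = tensor (single (a, m) c) (single (b, n) 1)" by (simp add: p)
  moreover have "lookup (diag_act (LL \<beta> j) (tensor (single (a, m) c) (single (b, n) 1))) ((\<alpha>, k), (\<delta>, l)) =
    (\<alpha> - 2 * \<beta>) * lookup (single p c) ((\<alpha> - \<beta>, k - j), (\<delta>, l)) + (\<delta> - 2 * \<beta>) * lookup (single p c) ((\<alpha>, k), (\<delta> - \<beta>, l - j))"
    unfolding diag_act_tensor LL_eq WL_bracket_single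
    by (auto simp: p lookup_add lookup_single when_def algebra_simps)
  ultimately show ?case by simp
qed (simp add: diag_act_add_right lookup_add algebra_simps)

lemma (in lie_module) is_derivation_diff:
  assumes "is_derivation L br V act D" "v \<in> V"
  shows "is_derivation L br V act (\<lambda>x. D x - act x v)"
proof -
  have diff: "act x (u - w) = act x u - act x w" if "x \<in> L" "u \<in> V" "w \<in> V" for x u w
    using act_add_right[OF that(1) pm.subspace_diff[OF subspace_V that(2,3)] that(3)]
    by (metis add_diff_cancel_right' diff_add_cancel)
  show ?thesis
    using assms inner_is_derivation[OF assms(2)] subspace_V
    unfolding is_derivation_def
    by (auto simp: pm.subspace_diff diff pm.scale_right_diff_distrib)
qed

lemma (in lie_module) H1_trivial:
  assumes "\<And>D. is_derivation L br V act D \<Longrightarrow> is_inner L V act D"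
  shows "H1 L br V act = {Inn L br V act}"
proof -
  have Inn: "Inn L br V act = Der L br V act" using assms by (auto simp: Inn_def Der_def)
  have rel: "{(D, E). D \<in> Der L br V act \<and> E \<in> Der L br V act \<and> (\<lambda>x. D x - E x) \<in> Inn L br V act}
      = Der L br V act \<times> Der L br V act"
    using Inn_diff unfolding Inn by blast
  show ?thesis
    using zero_in_Inn unfolding H1_def rel unfolding Inn quotient_def by auto
qed

lemma is_derivation_vanishes:
  assumes D: "is_derivation (WL \<Gamma>) br V act D" and LL: "\<And>\<beta> i. \<beta> \<in> \<Gamma> \<Longrightarrow> D (LL \<beta> i) = 0" and x: "x \<in> WL \<Gamma>"
  shows "D x = 0"
proof -
  have sub: "pm.subspace (WL \<Gamma>)" unfolding WL_eq by (rule subspace_keys)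
  have "x = (\<Sum>p\<in>keys x. scale (lookup x p) (single p 1))"
    by (rule poly_mapping_eqI) (simp add: lookup_sum lookup_single when_def in_keys_iff)
  moreover have "(\<Sum>p\<in>S. scale (lookup x p) (single p 1)) \<in> WL \<Gamma> \<and> D (\<Sum>p\<in>S. scale (lookup x p) (single p 1)) = 0"
    if "finite S" "S \<subseteq> \<Gamma> \<times> UNIV" for S
    using that
  proof (induction S)
    case empty
    have "D (scale 0 0) = scale 0 (D 0)"
      using D pm.subspace_0[OF sub] unfolding is_derivation_def by blast
    then show ?case using pm.subspace_0[OF sub] by simp
  next
    case (insert p S)
    obtain \<beta> i where p: "p = (\<beta>, i)" "\<beta> \<in> \<Gamma>" using insert by (cases p) auto
    let ?u = "scale (lookup x p) (single p 1)" and ?s = "\<Sum>p\<in>S. scale (lookup x p) (single p 1)"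
    have 1: "single p 1 \<in> WL \<Gamma>" using p by (auto simp: WL_eq)
    then have u: "?u \<in> WL \<Gamma>" by (rule pm.subspace_scale[OF sub])
    have "D ?u = scale (lookup x p) (D (single p 1))" using D 1 unfolding is_derivation_def by blast
    then have Du: "D ?u = 0" using LL[OF p(2), of i] by (simp add: LL_eq p)
    have s: "?s \<in> WL \<Gamma>" "D ?s = 0" using insert by auto
    have "D (?u + ?s) = D ?u + D ?s" using D u s unfolding is_derivation_def by blast
    then show ?case
      using Du s u insert.hyps pm.subspace_add[OF sub u s(1)] by (simp only: sum.insert) simp
  qed
  ultimately show ?thesis using x finite_keys[of x] unfolding WL_eq by (metis (no_types, lifting) mem_Collect_eq)
qed

context additive_group_with_one
begin

interpretation M: lie_module "WL \<Gamma>" WL_bracket "WL2 \<Gamma>" diag_act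
  by (rule WL_lie_module) (rule add_mem)

abbreviation "Derivation \<equiv> is_derivation (WL \<Gamma>) WL_bracket (WL2 \<Gamma>) diag_act"

lemma LL_mem: "\<beta> \<in> \<Gamma> \<Longrightarrow> LL \<beta> i \<in> WL \<Gamma>"
  by (auto simp: WL_eq LL_eq)

lemma derivation_LL:
  assumes "Derivation D" "\<beta> \<in> \<Gamma>" "\<gamma> \<in> \<Gamma>"
  shows "scale (\<gamma> - \<beta>) (D (LL (\<beta> + \<gamma>) (i + j))) = diag_act (LL \<beta> i) (D (LL \<gamma> j)) - diag_act (LL \<gamma> j) (D (LL \<beta> i))"
proof -
  have "D (scale (\<gamma> - \<beta>) (LL (\<beta> + \<gamma>) (i + j))) = scale (\<gamma> - \<beta>) (D (LL (\<beta> + \<gamma>) (i + j)))"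
    using assms LL_mem[OF add_mem] unfolding is_derivation_def by blast
  moreover have "D (WL_bracket (LL \<beta> i) (LL \<gamma> j)) = diag_act (LL \<beta> i) (D (LL \<gamma> j)) - diag_act (LL \<gamma> j) (D (LL \<beta> i))"
    using assms LL_mem unfolding is_derivation_def by blast
  ultimately show ?thesis by (simp add: WL_bracket_LL)
qed

lemma lookup_derivation_LL:
  assumes "Derivation D" "\<beta> \<in> \<Gamma>" "\<gamma> \<in> \<Gamma>"
  shows "(\<gamma> - \<beta>) * lookup (D (LL (\<beta> + \<gamma>) (i + j))) ((\<alpha>, k), (\<delta>, l)) =
      ((\<alpha> - 2 * \<beta>) * lookup (D (LL \<gamma> j)) ((\<alpha> - \<beta>, k - i), (\<delta>, l))
        + (\<delta> - 2 * \<beta>) * lookup (D (LL \<gamma> j)) ((\<alpha>, k), (\<delta> - \<beta>, l - i)))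
    - ((\<alpha> - 2 * \<gamma>) * lookup (D (LL \<beta> i)) ((\<alpha> - \<gamma>, k - j), (\<delta>, l))
        + (\<delta> - 2 * \<gamma>) * lookup (D (LL \<beta> i)) ((\<alpha>, k), (\<delta> - \<gamma>, l - j)))"
  using arg_cong[OF derivation_LL[OF assms, of i j], of "\<lambda>v. lookup v ((\<alpha>, k), (\<delta>, l))"]
  by (simp add: lookup_minus lookup_diag_act_LL)

lemma lookup_outside:
  assumes "v \<in> WL2 \<Gamma>" "\<alpha> \<notin> \<Gamma> \<or> \<delta> \<notin> \<Gamma>"
  shows "lookup v ((\<alpha>, k), (\<delta>, l)) = 0"
  using assms by (auto simp: WL2_eq in_keys_iff)

text \<open>
  Dividing \<open>D L\<^sub>0\<close> by the weight \<open>\<alpha> + \<delta>\<close> (with \<open>c / 0 = 0\<close>) gives \<open>v\<close> such that the difference \<open>D'\<close> has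
  \<open>D' L\<^sub>0\<close> of weight \<open>0\<close>. The bracket with \<open>L\<^sub>0\<close> then confines \<open>D' L\<^sub>\<beta>\<close> to weight \<open>\<beta>\<close>, and in weight
  \<open>\<beta>\<close> it says that \<open>L\<^sub>\<beta>\<close> kills \<open>D' L\<^sub>0\<close>. So \<open>D' L\<^sub>0\<close> is an invariant of weight \<open>0\<close>, which must be \<open>0\<close>.
\<close>

lemma normalize_weight:
  assumes D: "Derivation D"
  obtains v where "v \<in> WL2 \<Gamma>" "D (LL 0 0) = diag_act (LL 0 0) v"
    "\<And>\<beta> \<alpha> k \<delta> l. \<beta> \<in> \<Gamma> \<Longrightarrow> \<alpha> + \<delta> \<noteq> \<beta> \<Longrightarrow> lookup (D (LL \<beta> 0) - diag_act (LL \<beta> 0) v) ((\<alpha>, k), (\<delta>, l)) = 0"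
proof -
  define u where "u = D (LL 0 0)"
  define v where "v = Poly_Mapping.mapp (\<lambda>((\<alpha>, k), (\<delta>, l)) c. c / (\<alpha> + \<delta>)) u"
  have v_lookup: "lookup v ((\<alpha>, k), (\<delta>, l)) = lookup u ((\<alpha>, k), (\<delta>, l)) / (\<alpha> + \<delta>)" for \<alpha> k \<delta> l
    by (simp add: v_def lookup_mapp when_def in_keys_iff)
  have u: "u \<in> WL2 \<Gamma>" using D LL_mem[OF zero_mem] unfolding u_def is_derivation_def by blast
  have v: "v \<in> WL2 \<Gamma>"
  proof -
    have "keys v \<subseteq> keys u" by (auto simp: in_keys_iff v_lookup)
    then show ?thesis using u by (auto simp: WL2_eq)
  qed
  define D' where "D' x = D x - diag_act x v" for x
  have D': "Derivation D'" unfolding D'_def by (rule M.is_derivation_diff[OF D v])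
  have weight0: "lookup (D' (LL 0 0)) ((\<alpha>, k), (\<delta>, l)) = 0" if "\<alpha> + \<delta> \<noteq> 0" for \<alpha> k \<delta> l
  proof -
    have "(\<alpha> + \<delta>) * (lookup u ((\<alpha>, k), (\<delta>, l)) / (\<alpha> + \<delta>)) = lookup u ((\<alpha>, k), (\<delta>, l))" using that by simp
    then show ?thesis
      by (simp add: D'_def lookup_minus lookup_diag_act_LL v_lookup
          flip: u_def add_divide_distrib distrib_right)
  qed
  have L0: "(\<beta> - (\<alpha> + \<delta>)) * lookup (D' (LL \<beta> 0)) ((\<alpha>, k), (\<delta>, l)) =
      - ((\<alpha> - 2 * \<beta>) * lookup (D' (LL 0 0)) ((\<alpha> - \<beta>, k), (\<delta>, l))
        + (\<delta> - 2 * \<beta>) * lookup (D' (LL 0 0)) ((\<alpha>, k), (\<delta> - \<beta>, l)))"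
    if "\<beta> \<in> \<Gamma>" for \<beta> \<alpha> k \<delta> l
    using lookup_derivation_LL[OF D' zero_mem that, of 0 0] by (simp add: algebra_simps)
  have invariant: "0 = (\<alpha> - 2 * \<beta>) * lookup (D' (LL 0 0)) ((\<alpha> - \<beta>, k), (- (\<alpha> - \<beta>), l))
      - (\<alpha> + \<beta>) * lookup (D' (LL 0 0)) ((\<alpha>, k), (- \<alpha>, l))"
    if "\<beta> \<in> \<Gamma>" for \<beta> \<alpha> k l
    using L0[OF that, of \<alpha> "\<beta> - \<alpha>" k l] by (simp add: algebra_simps)
  have "lookup (D' (LL 0 0)) ((\<alpha>, k), (- \<alpha>, l)) = 0" for \<alpha> k l
    using invariant[of 1 \<alpha> k l] invariant[of 1 "\<alpha> - 1" k l] invariant[of 2 \<alpha> k l]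
    by (intro no_invariants_at[of \<alpha> "lookup (D' (LL 0 0)) ((\<alpha> - 1, k), (- (\<alpha> - 1), l))" _
          "lookup (D' (LL 0 0)) ((\<alpha> - 2, k), (- (\<alpha> - 2), l))"]) (simp_all add: mem)
  then have "lookup (D' (LL 0 0)) ((\<alpha>, k), (\<delta>, l)) = 0" for \<alpha> k \<delta> l
    using weight0[of \<alpha> \<delta>] by (cases "\<alpha> + \<delta> = 0") (auto dest: minus_unique)
  then have D'0: "D' (LL 0 0) = 0" by (intro poly_mapping_eqI) (metis lookup_zero surj_pair)
  show ?thesis
  proof (rule that)
    show "v \<in> WL2 \<Gamma>" by (rule v)
    show "D (LL 0 0) = diag_act (LL 0 0) v" using D'0 by (simp add: D'_def)
    show "lookup (D (LL \<beta> 0) - diag_act (LL \<beta> 0) v) ((\<alpha>, k), (\<delta>, l)) = 0" if "\<beta> \<in> \<Gamma>" "\<alpha> + \<delta> \<noteq> \<beta>" for \<beta> \<alpha> k \<delta> l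
      using L0[OF that(1), of \<alpha> \<delta> k l] that(2) by (simp add: D'0 flip: D'_def)
  qed
qed

text \<open>
  Each label \<open>(k, l)\<close> has its own primitive \<open>c k l\<close>. They fit into a single finitely supported \<open>v\<close>
  because a nonzero value \<open>c k l \<alpha>\<close> forces a nonzero coefficient of \<open>D' L\<^sub>1\<close> or \<open>D' L\<^sub>2\<close> with the same
  label and with first index \<open>\<alpha>\<close> or \<open>\<alpha> - 1\<close>.
\<close>

lemma inner_on_witt_subalgebra:
  assumes D: "Derivation D"
  obtains v where "v \<in> WL2 \<Gamma>" "\<And>\<beta>. \<beta> \<in> \<Gamma> \<Longrightarrow> D (LL \<beta> 0) = diag_act (LL \<beta> 0) v"
proof -
  obtain v0 where v0: "v0 \<in> WL2 \<Gamma>" "D (LL 0 0) = diag_act (LL 0 0) v0"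
    "\<And>\<beta> \<alpha> k \<delta> l. \<beta> \<in> \<Gamma> \<Longrightarrow> \<alpha> + \<delta> \<noteq> \<beta> \<Longrightarrow> lookup (D (LL \<beta> 0) - diag_act (LL \<beta> 0) v0) ((\<alpha>, k), (\<delta>, l)) = 0"
    using normalize_weight[OF D] by blast
  define D' where "D' x = D x - diag_act x v0" for x
  have D': "Derivation D'" unfolding D'_def by (rule M.is_derivation_diff[OF D v0(1)])
  have zero: "D' (LL 0 0) = 0" and weight: "\<And>\<beta> \<alpha> k \<delta> l. \<beta> \<in> \<Gamma> \<Longrightarrow> \<alpha> + \<delta> \<noteq> \<beta> \<Longrightarrow> lookup (D' (LL \<beta> 0)) ((\<alpha>, k), (\<delta>, l)) = 0"
    using v0 by (simp_all add: D'_def)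
  define d where "d k l \<beta> \<alpha> = lookup (D' (LL \<beta> 0)) ((\<alpha>, k), (\<beta> - \<alpha>, l))" for k l \<beta> \<alpha>
  have "\<exists>c. \<forall>\<beta>\<in>\<Gamma>. \<forall>\<alpha>\<in>\<Gamma>. d k l \<beta> \<alpha> = (\<alpha> - 2 * \<beta>) * c (\<alpha> - \<beta>) - (\<alpha> + \<beta>) * c \<alpha>" for k l
  proof (rule cocycle_is_coboundary[of "d k l"])
    show "(\<gamma> - \<beta>) * d k l (\<beta> + \<gamma>) \<alpha> =
        ((\<alpha> - 2 * \<beta>) * d k l \<gamma> (\<alpha> - \<beta>) + (\<gamma> - \<alpha> - \<beta>) * d k l \<gamma> \<alpha>)
      - ((\<alpha> - 2 * \<gamma>) * d k l \<beta> (\<alpha> - \<gamma>) + (\<beta> - \<alpha> - \<gamma>) * d k l \<beta> \<alpha>)"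
      if "\<beta> \<in> \<Gamma>" "\<gamma> \<in> \<Gamma>" "\<alpha> \<in> \<Gamma>" for \<beta> \<gamma> \<alpha>
    proof -
      have "\<beta> + \<gamma> - \<alpha> - \<beta> = \<gamma> - \<alpha>" "\<beta> + \<gamma> - \<alpha> - \<gamma> = \<beta> - \<alpha>" "\<gamma> - (\<alpha> - \<beta>) = \<beta> + \<gamma> - \<alpha>" "\<beta> - (\<alpha> - \<gamma>) = \<beta> + \<gamma> - \<alpha>"
        "\<beta> + \<gamma> - \<alpha> - 2 * \<beta> = \<gamma> - \<alpha> - \<beta>" "\<beta> + \<gamma> - \<alpha> - 2 * \<gamma> = \<beta> - \<alpha> - \<gamma>"
        by (simp_all add: algebra_simps)
      then show ?thesis
        using lookup_derivation_LL[OF D' that(1,2), of 0 0 \<alpha> k "\<beta> + \<gamma> - \<alpha>" l]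
        by (simp only: d_def add_0 diff_0_right)
    qed
  qed (auto simp: d_def zero)
  then obtain c where c: "\<And>k l \<beta> \<alpha>. \<beta> \<in> \<Gamma> \<Longrightarrow> \<alpha> \<in> \<Gamma> \<Longrightarrow> d k l \<beta> \<alpha> = (\<alpha> - 2 * \<beta>) * c k l (\<alpha> - \<beta>) - (\<alpha> + \<beta>) * c k l \<alpha>"
    by metis
  define f where "f = (\<lambda>((\<alpha>, k), (\<delta>, l)). if \<alpha> \<in> \<Gamma> \<and> \<delta> = - \<alpha> then c k l \<alpha> else 0)"
  have f: "f ((\<alpha>, k), (\<delta>, l)) = (if \<alpha> \<in> \<Gamma> \<and> \<delta> = - \<alpha> then c k l \<alpha> else 0)" for \<alpha> k \<delta> l
    by (simp add: f_def)
  have support: "c k l \<alpha> = 0"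
    if \<alpha>: "\<alpha> \<in> \<Gamma>" and "d k l 1 (\<alpha> - 1) = 0" "d k l 1 \<alpha> = 0" "d k l 2 \<alpha> = 0" for k l \<alpha>
  proof -
    have "(\<alpha> - 2) * c k l (\<alpha> - 1) = (\<alpha> + 1) * c k l \<alpha>"
      "(\<alpha> - 3) * c k l (\<alpha> - 2) = \<alpha> * c k l (\<alpha> - 1)"
      "(\<alpha> - 4) * c k l (\<alpha> - 2) = (\<alpha> + 2) * c k l \<alpha>"
      using c[of 1 \<alpha> k l] c[of 1 "\<alpha> - 1" k l] c[of 2 \<alpha> k l] that by (simp_all add: mem)
    then show ?thesis by (rule no_invariants_at)
  qed
  define K where "K = keys (D' (LL 1 0)) \<union> keys (D' (LL 2 0))"
  have "{x. f x \<noteq> 0} \<subseteq> (\<lambda>(s, ((\<alpha>, k), (\<delta>, l))). ((\<alpha> + s, k), (- (\<alpha> + s), l))) ` ({0, 1} \<times> K)"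
  proof
    fix x assume "x \<in> {x. f x \<noteq> 0}"
    moreover obtain \<alpha> k \<delta> l where "x = ((\<alpha>, k), (\<delta>, l))" by (metis surj_pair)
    ultimately have x: "x = ((\<alpha>, k), (- \<alpha>, l))" and \<alpha>: "\<alpha> \<in> \<Gamma>" "c k l \<alpha> \<noteq> 0"
      by (auto simp: f split: if_splits)
    then have "d k l 1 (\<alpha> - 1) \<noteq> 0 \<or> d k l 1 \<alpha> \<noteq> 0 \<or> d k l 2 \<alpha> \<noteq> 0" using support by blast
    then have "((\<alpha> - 1, k), (1 - (\<alpha> - 1), l)) \<in> K \<or> ((\<alpha>, k), (1 - \<alpha>, l)) \<in> K \<or> ((\<alpha>, k), (2 - \<alpha>, l)) \<in> K"
      by (simp add: d_def K_def in_keys_iff)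
    then show "x \<in> (\<lambda>(s, ((\<alpha>, k), (\<delta>, l))). ((\<alpha> + s, k), (- (\<alpha> + s), l))) ` ({0, 1} \<times> K)"
      unfolding x by (elim disjE) (force intro: rev_image_eqI)+
  qed
  then have fin: "finite {x. f x \<noteq> 0}" by (rule finite_subset) (simp add: K_def)
  define v1 where "v1 = Abs_poly_mapping f"
  have v1: "lookup v1 = f" unfolding v1_def by (rule lookup_Abs_poly_mapping[OF fin])
  have v1_mem: "v1 \<in> WL2 \<Gamma>" by (auto simp: WL2_eq in_keys_iff v1 f mem split: if_splits)
  have "D' (LL \<beta> 0) = diag_act (LL \<beta> 0) v1" if \<beta>: "\<beta> \<in> \<Gamma>" for \<beta>
  proof (rule poly_mapping_eqI)
    fix x :: "('f \<times> int) \<times> ('f \<times> int)"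
    obtain \<alpha> k \<delta> l where x: "x = ((\<alpha>, k), (\<delta>, l))" by (metis surj_pair)
    show "lookup (D' (LL \<beta> 0)) x = lookup (diag_act (LL \<beta> 0) v1) x"
    proof (cases "\<alpha> + \<delta> = \<beta>")
      case False
      then have "\<delta> \<noteq> - (\<alpha> - \<beta>)" "\<delta> - \<beta> \<noteq> - \<alpha>" by (auto simp: algebra_simps)
      then show ?thesis using weight[OF \<beta> False] by (simp add: x lookup_diag_act_LL v1 f)
    next
      case True
      then have \<delta>: "\<delta> = \<beta> - \<alpha>" by (simp add: algebra_simps)
      show ?thesis
      proof (cases "\<alpha> \<in> \<Gamma>")
        case True
        have "lookup (D' (LL \<beta> 0)) x = d k l \<beta> \<alpha>" by (simp add: x d_def \<delta>)
        also have "\<dots> = (\<alpha> - 2 * \<beta>) * c k l (\<alpha> - \<beta>) - (\<alpha> + \<beta>) * c k l \<alpha>" by (rule c[OF \<beta> True])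
        also have "\<dots> = lookup (diag_act (LL \<beta> 0) v1) x"
          using True \<beta> by (simp add: x \<delta> lookup_diag_act_LL v1 f diff_mem algebra_simps)
        finally show ?thesis .
      next
        case False
        then have "\<alpha> - \<beta> \<notin> \<Gamma>" using add_mem[OF _ \<beta>, of "\<alpha> - \<beta>"] by auto
        moreover have "D' (LL \<beta> 0) \<in> WL2 \<Gamma>" using D' LL_mem[OF \<beta>] unfolding is_derivation_def by blast
        ultimately show ?thesis using False by (simp add: x lookup_diag_act_LL v1 f lookup_outside)
      qed
    qed
  qed
  then have "D (LL \<beta> 0) = diag_act (LL \<beta> 0) (v0 + v1)" if "\<beta> \<in> \<Gamma>" for \<beta>
    using that by (simp add: D'_def diag_act_add_right algebra_simps)
  moreover have "v0 + v1 \<in> WL2 \<Gamma>" using M.subspace_V v0(1) v1_mem by (rule pm.subspace_add)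
  ultimately show ?thesis using that by blast
qed

text \<open>
  For fixed \<open>i\<close>, \<open>k\<close>, \<open>l\<close> the coefficients of \<open>D (LL \<beta> i)\<close> form an equivariant map in the sense of
  \<open>equivariant_map_vanishes\<close>: bracketing \<open>LL \<gamma> i\<close> with \<open>L\<^sub>\<beta>\<close> leaves \<open>i\<close> unchanged, and the
  term with \<open>D L\<^sub>\<beta>\<close> drops out.
\<close>

lemma vanishes_on_loops:
  assumes D: "Derivation D" and zero: "\<And>\<beta>. \<beta> \<in> \<Gamma> \<Longrightarrow> D (LL \<beta> 0) = 0" and \<beta>: "\<beta> \<in> \<Gamma>"
  shows "D (LL \<beta> i) = 0"
proof (rule poly_mapping_eqI)
  fix x :: "('f \<times> int) \<times> ('f \<times> int)"
  obtain \<alpha> k \<delta> l where x: "x = ((\<alpha>, k), (\<delta>, l))" by (metis surj_pair)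
  have equivariant: "(\<gamma> - \<beta>) * lookup (D (LL (\<beta> + \<gamma>) i)) ((\<alpha>, k), (\<delta>, l)) =
      (\<alpha> - 2 * \<beta>) * lookup (D (LL \<gamma> i)) ((\<alpha> - \<beta>, k), (\<delta>, l)) + (\<delta> - 2 * \<beta>) * lookup (D (LL \<gamma> i)) ((\<alpha>, k), (\<delta> - \<beta>, l))"
    if "\<beta> \<in> \<Gamma>" "\<gamma> \<in> \<Gamma>" for \<beta> \<gamma> \<alpha> k \<delta> l
    using lookup_derivation_LL[OF D that, of 0 i] by (simp add: zero that)
  have inside: "lookup (D (LL \<beta> i)) ((\<alpha>, k), (\<beta> - \<alpha>, l)) = 0" if "\<beta> \<in> \<Gamma>" "\<alpha> \<in> \<Gamma>" for \<beta> \<alpha>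
  proof (rule equivariant_map_vanishes[of "\<lambda>\<beta> \<alpha>. lookup (D (LL \<beta> i)) ((\<alpha>, k), (\<beta> - \<alpha>, l))"])
    fix \<beta> \<gamma> \<alpha> assume m: "\<beta> \<in> \<Gamma>" "\<gamma> \<in> \<Gamma>" "\<alpha> \<in> \<Gamma>"
    have eqs: "\<beta> + \<gamma> - \<alpha> - \<beta> = \<gamma> - \<alpha>" "\<gamma> - (\<alpha> - \<beta>) = \<beta> + \<gamma> - \<alpha>" "\<beta> + \<gamma> - \<alpha> - 2 * \<beta> = \<gamma> - \<alpha> - \<beta>"
      by (simp_all add: algebra_simps)
    show "(\<gamma> - \<beta>) * lookup (D (LL (\<beta> + \<gamma>) i)) ((\<alpha>, k), (\<beta> + \<gamma> - \<alpha>, l)) =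
        (\<alpha> - 2 * \<beta>) * lookup (D (LL \<gamma> i)) ((\<alpha> - \<beta>, k), (\<gamma> - (\<alpha> - \<beta>), l))
        + (\<gamma> - \<alpha> - \<beta>) * lookup (D (LL \<gamma> i)) ((\<alpha>, k), (\<gamma> - \<alpha>, l))"
      using equivariant[OF m(1,2), of \<alpha> k "\<beta> + \<gamma> - \<alpha>" l] by (simp only: eqs)
  qed (fact that)+
  have "lookup (D (LL \<beta> i)) x = 0"
  proof (cases "\<alpha> + \<delta> = \<beta>")
    case True
    then have \<delta>: "\<delta> = \<beta> - \<alpha>" by (simp add: algebra_simps)
    have "D (LL \<beta> i) \<in> WL2 \<Gamma>" using D LL_mem[OF \<beta>] unfolding is_derivation_def by blast
    then show ?thesis
      using inside[OF \<beta>, of \<alpha>] by (cases "\<alpha> \<in> \<Gamma>") (simp_all add: x \<delta> lookup_outside)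
  next
    case False
    have "(\<beta> - (\<alpha> + \<delta>)) * lookup (D (LL \<beta> i)) x = 0"
      using equivariant[OF zero_mem \<beta>, of \<alpha> k \<delta> l] by (simp add: x algebra_simps)
    then show ?thesis using False by simp
  qed
  then show "lookup (D (LL \<beta> i)) x = lookup 0 x" by simp
qed

lemma derivation_is_inner:
  assumes D: "Derivation D"
  shows "is_inner (WL \<Gamma>) (WL2 \<Gamma>) diag_act D"
proof -
  obtain v where v: "v \<in> WL2 \<Gamma>" "\<And>\<beta>. \<beta> \<in> \<Gamma> \<Longrightarrow> D (LL \<beta> 0) = diag_act (LL \<beta> 0) v"
    using inner_on_witt_subalgebra[OF D] by blast
  have D': "Derivation (\<lambda>x. D x - diag_act x v)" by (rule M.is_derivation_diff[OF D v(1)])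
  have "D x - diag_act x v = 0" if "x \<in> WL \<Gamma>" for x
    using is_derivation_vanishes[OF D' vanishes_on_loops[OF D'] that] v(2) by simp
  then show ?thesis using v(1) by (auto simp: is_inner_def)
qed

end

theorem proposition3p4:
  fixes \<Gamma> :: "'f::field_char_0 set"
  assumes "0 \<in> \<Gamma>"
    and "\<And>\<alpha> \<beta>. \<alpha> \<in> \<Gamma> \<Longrightarrow> \<beta> \<in> \<Gamma> \<Longrightarrow> \<alpha> + \<beta> \<in> \<Gamma>"
    and "\<And>\<alpha>. \<alpha> \<in> \<Gamma> \<Longrightarrow> - \<alpha> \<in> \<Gamma>"
    and "1 \<in> \<Gamma>"
  shows "(\<forall>D. is_derivation (WL \<Gamma>) WL_bracket (WL2 \<Gamma>) diag_act D
                \<longrightarrow> is_inner (WL \<Gamma>) (WL2 \<Gamma>) diag_act D)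
       \<and> H1 (WL \<Gamma>) WL_bracket (WL2 \<Gamma>) diag_act = {Inn (WL \<Gamma>) WL_bracket (WL2 \<Gamma>) diag_act}"
proof -
  interpret additive_group_with_one \<Gamma> by unfold_locales (fact assms)+
  interpret lie_module "WL \<Gamma>" WL_bracket "WL2 \<Gamma>" diag_act by (rule WL_lie_module) (rule assms(2))
  show ?thesis using derivation_is_inner H1_trivial by blast
qed

end
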